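(* Let $d\ge3$, $\phi>0$, $\epsilon\in(0,1]$, and let $\Sigma$ be a $d\times d$ symmetric positive definite matrix with unit diagonal entries; let $\sigma_*>0$ be the square root of the smallest eigenvalue of $\Sigma$. Let $A=\prod_{j=1}^d(a_j,b_j]\in\mathcal R$ and let $v\in\mathbb Z$ be such that $v\ge1$. Then for all $\kappa,\eta>0$ with $\kappa>\eta$, $$\sup_{w\in (A^{2\epsilon\kappa+ \phi^{-1}}\setminus A^{-2\epsilon\kappa})^c}\ \sum_{j_1,\dots,j_v=1}^d\ \sup_{y\in R(0,\epsilon\sigma_*\eta)}|\partial_{j_1,\dots, j_v}\rho^{A,\phi,\epsilon,\Sigma} (w+y)| \leq C\frac{d^v}{(\epsilon\sigma_* )^{v}}e^{-(\kappa-\eta)^2/4},$$ where $C>0$ is a constant depending only on $v$.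
   Context: $\mathcal R$ is the class of rectangles $A=\prod_{j=1}^d(a_j,b_j]$ in $\mathbb R^d$ with $-\infty\le a_j\le b_j\le\infty$. For $A=\prod_{j=1}^d(a_j,b_j]\in\mathcal R$ and $t\in\mathbb R$, $A^t:=\prod_{j=1}^d(a_j-t,b_j+t]$ (empty if some factor is empty); the superscript $c$ denotes complement in $\mathbb R^d$. $R(0,t):=\{y\in\mathbb R^d:\|y\|_\infty\le t\}$, with $\|y\|_\infty=\max_j|y_j|$. $\partial_{j_1,\dots,j_v}$ denotes the $v$-th order partial derivative with respect to coordinates $j_1,\dots,j_v$. The function $g^\phi:\mathbb R\to\mathbb R$ is given by $g^\phi(t)=1$ for $t\le0$, $g^\phi(t)=1-\phi t$ for $0<t<1/\phi$, and $g^\phi(t)=0$ for $t\ge1/\phi$. Further, $$m^{A,\phi}(w):=g^\phi\Big(\max_{1\le j\le d}[(w_j-b_j)\vee(a_j-w_j)]\Big),\qquad \rho^{A,\phi,\epsilon,\Sigma}(w):=\mathrm E\, m^{A,\phi}(w+\epsilon Z),\quad w\in\mathbb R^d,$$ where $Z\sim N(0,\Sigma)$ in $\mathbb R^d$. *)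

theory Defs
  imports "HOL-Probability.Probability" "Jordan_Normal_Form.Spectral_Radius"
begin

unbundle no vec_syntax
unbundle no inner_syntax

text \<open>
  The constant in the main estimate must not depend on the dimension \<open>d\<close>, so \<open>d\<close> has to be
  quantified inside the formula. Points of \<open>d\<close>-dimensional space are therefore the elements of
  \<^term>\<open>carrier_vec d :: real vec set\<close>, with coordinates numbered \<open>0, \<dots>, d - 1\<close>.
  A rectangle is given by its families of endpoints \<open>a, b :: nat \<Rightarrow> ereal\<close> (only the values at
  indices below \<open>d\<close> matter); \<open>enlarged_rect\<close> and \<open>m_fun\<close> are functions of the endpoints, not of
  the underlying set, since they tell different representations of the empty set apart.
\<close>

definition enlarged_rect :: "nat \<Rightarrow> (nat \<Rightarrow> ereal) \<Rightarrow> (nat \<Rightarrow> ereal) \<Rightarrow> real \<Rightarrow> real vec set" where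
  "enlarged_rect d a b t =
     {w \<in> carrier_vec d. \<forall>j<d. a j - ereal t < ereal (w $ j) \<and> ereal (w $ j) \<le> b j + ereal t}"

definition linf_norm :: "real vec \<Rightarrow> real" where
  "linf_norm y = Max ((\<lambda>j. \<bar>y $ j\<bar>) ` {..<dim_vec y})"

definition cube :: "nat \<Rightarrow> real \<Rightarrow> real vec set" where
  "cube d t = {y \<in> carrier_vec d. linf_norm y \<le> t}"

text \<open>
  The ramp takes an extended real argument because the maximum in \<open>m_fun\<close> is infinite when
  endpoints are infinite; its values at \<open>-\<infinity>\<close> and \<open>\<infinity>\<close> are the limits 1 and 0.
\<close>

definition ramp :: "real \<Rightarrow> ereal \<Rightarrow> real" where
  "ramp \<phi> t =
     (if t \<le> 0 then 1 else if t < ereal (1 / \<phi>) then 1 - \<phi> * real_of_ereal t else 0)"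

definition m_fun :: "nat \<Rightarrow> (nat \<Rightarrow> ereal) \<Rightarrow> (nat \<Rightarrow> ereal) \<Rightarrow> real \<Rightarrow> real vec \<Rightarrow> real" where
  "m_fun d a b \<phi> w =
     ramp \<phi> (Max ((\<lambda>j. max (ereal (w $ j) - b j) (a j - ereal (w $ j))) ` {..<d}))"

definition sym_pos_def :: "nat \<Rightarrow> real mat \<Rightarrow> bool" where
  "sym_pos_def d S \<longleftrightarrow>
     S \<in> carrier_mat d d \<and> transpose_mat S = S \<and>
     (\<forall>x \<in> carrier_vec d. x \<noteq> 0\<^sub>v d \<longrightarrow> 0 < x \<bullet> (S *\<^sub>v x))"

definition sigma_star :: "real mat \<Rightarrow> real" where
  "sigma_star S = sqrt (Min (spectrum S))"

text \<open>
  The law \<open>N(0, S)\<close> for positive definite \<open>S\<close>, through its Lebesgue density. It lives on the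
  product space over \<open>{..<d}\<close>; \<^term>\<open>vec d z\<close> turns a sample into a vector.
\<close>

definition normal_density_mat :: "nat \<Rightarrow> real mat \<Rightarrow> real vec \<Rightarrow> real" where
  "normal_density_mat d S x =
     exp (- (x \<bullet> (the (mat_inverse S) *\<^sub>v x)) / 2) / sqrt ((2 * pi) ^ d * Determinant.det S)"

definition normal_law :: "nat \<Rightarrow> real mat \<Rightarrow> (nat \<Rightarrow> real) measure" where
  "normal_law d S =
     density (Pi\<^sub>M {..<d} (\<lambda>_. lborel)) (\<lambda>z. ennreal (normal_density_mat d S (vec d z)))"

definition rho ::
  "nat \<Rightarrow> (nat \<Rightarrow> ereal) \<Rightarrow> (nat \<Rightarrow> ereal) \<Rightarrow> real \<Rightarrow> real \<Rightarrow> real mat \<Rightarrow> real vec \<Rightarrow> real" where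
  "rho d a b \<phi> \<epsilon> S w = (\<integral>z. m_fun d a b \<phi> (w + \<epsilon> \<cdot>\<^sub>v vec d z) \<partial>normal_law d S)"

definition partial_deriv :: "nat \<Rightarrow> nat \<Rightarrow> (real vec \<Rightarrow> real) \<Rightarrow> real vec \<Rightarrow> real" where
  "partial_deriv d j f w = deriv (\<lambda>t. f (w + t \<cdot>\<^sub>v unit_vec d j)) 0"

definition partial_derivs :: "nat \<Rightarrow> nat list \<Rightarrow> (real vec \<Rightarrow> real) \<Rightarrow> real vec \<Rightarrow> real" where
  "partial_derivs d js f = foldr (partial_deriv d) js f"

end

theory Submission
  imports Defs
begin

text \<open>
  Write \<open>Z = N(0, S)\<close>, let \<open>p\<close> be its density and \<open>B\<close> the inverse of \<open>S\<close>, and let \<open>\<sigma>\<close> be the square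
  root of the smallest eigenvalue of \<open>S\<close>. After a change of variables, \<open>w\<close> occurs in
  \<open>\<rho> w = E (m (w + \<epsilon> Z))\<close> only through the smooth factor \<open>p\<close>, so every partial derivative of \<open>\<rho>\<close> of
  order \<open>v\<close> is \<open>(- 1 / \<epsilon>)\<^sup>v E (m (w + \<epsilon> Z) H Z)\<close>, where \<open>H p\<close> is the corresponding derivative of \<open>p\<close>.
  The factor \<open>H\<close> is a polynomial in the functionals \<open>L j z = (B z) j\<close> and the entries of \<open>B\<close>. Since
  \<open>\<bar>B i j\<bar> \<le> 1 / \<sigma>\<^sup>2\<close> and \<open>L j Z\<close> has variance \<open>B j j\<close>, it is of size \<open>\<sigma>\<^sup>-\<^sup>v\<close> with a constant that sees
  only \<open>v\<close>, because \<open>H\<close> involves only the at most \<open>v\<close> coordinates in which one differentiates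
  (\<open>partial_derivs_smoothing\<close>, \<open>scaled_poly_bound\<close>).

  The Gaussian factor comes from a cancellation that reduces the constraints on all \<open>d\<close> coordinates to
  one of them; a union bound would cost a further factor \<open>d\<close>.
  If \<open>w\<close> lies deep inside the rectangle, drop from \<open>m\<close> the constraint on the coordinate \<open>j\<close> of the last
  differentiation. The resulting function does not depend on that coordinate, so its smoothing has
  derivative zero, and \<open>m\<close> may be replaced by the difference of the two functions; this difference
  vanishes unless \<open>\<bar>Z j\<bar>\<close> is at least \<open>2 \<kappa> - \<eta>\<close>. If \<open>w\<close> lies far outside, one violated constraint \<open>k\<close>
  makes \<open>m (w + \<epsilon> Z)\<close> vanish unless \<open>\<bar>Z k\<bar>\<close> is at least \<open>2 \<kappa> - \<eta>\<close>
  (\<open>partial_derivs_rect_ramp_bound\<close>). In both cases the expectation is restricted to the tail of a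
  single standard normal variable, and Markov's inequality with an exponential weight, which absorbs
  \<open>\<bar>H\<bar>\<close> as well, gives the bound (\<open>tail_exp_W\<close>). The only integrals ever evaluated are the
  normalization of \<open>p\<close> (\<open>gaussian_integral\<close>) and its exponential moments, which follow by completing
  the square (\<open>exponential_moment\<close>). Summing over the \<open>d\<^sup>v\<close> index tuples yields the theorem.
\<close>

section \<open>Gaussian integrals in coordinates\<close>

text \<open>
  Quadratic forms and points of the space are kept as functions on \<open>nat\<close>, of which only the values at
  indices below \<open>d\<close> matter. This is the form in which the product measure presents its points, and it
  lets the dimension vary in inductions.
\<close>

definition quad :: "nat \<Rightarrow> (nat \<Rightarrow> nat \<Rightarrow> real) \<Rightarrow> (nat \<Rightarrow> real) \<Rightarrow> real" where
  "quad d B x = (\<Sum>i<d. \<Sum>j<d. B i j * x i * x j)"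

definition lebesgue_pow :: "nat \<Rightarrow> (nat \<Rightarrow> real) measure" where
  "lebesgue_pow d = Pi\<^sub>M {..<d} (\<lambda>_. lborel)"

lemma measurable_lebesgue_pow_component [measurable (raw)]:
  "i < d \<Longrightarrow> (\<lambda>x. x i) \<in> borel_measurable (lebesgue_pow d)"
  using measurable_component_singleton[of i "{..<d}" "\<lambda>_. lborel :: real measure"]
  by (simp add: lebesgue_pow_def)

lemma quad_measurable [measurable]: "quad d B \<in> borel_measurable (lebesgue_pow d)"
  unfolding quad_def[abs_def] by (intro borel_measurable_sum borel_measurable_times) auto

lemma nn_integral_lebesgue_pow_Suc:
  assumes "f \<in> borel_measurable (lebesgue_pow (Suc d))"
  shows "(\<integral>\<^sup>+x. f x \<partial>lebesgue_pow (Suc d)) =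
    (\<integral>\<^sup>+x. (\<integral>\<^sup>+y. f (x(d := y)) \<partial>lborel) \<partial>lebesgue_pow d)"
proof -
  interpret product_sigma_finite "\<lambda>_::nat. lborel :: real measure" by standard
  show ?thesis
    using product_nn_integral_insert[of "{..<d}" d f] assms
    by (simp add: lebesgue_pow_def lessThan_Suc)
qed

definition translate :: "nat \<Rightarrow> (nat \<Rightarrow> real) \<Rightarrow> (nat \<Rightarrow> real) \<Rightarrow> nat \<Rightarrow> real" where
  "translate d h x = (\<lambda>i\<in>{..<d}. x i + h i)"

lemma translate_apply: "i < d \<Longrightarrow> translate d h x i = x i + h i"
  by (simp add: translate_def)

lemma translate_measurable [measurable]: "translate d h \<in> measurable (lebesgue_pow d) (lebesgue_pow d)"
proof -
  have "(\<lambda>x. \<lambda>i\<in>{..<d}. x i + h i) \<in> measurable (lebesgue_pow d) (Pi\<^sub>M {..<d} (\<lambda>_. lborel))"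
    by (rule measurable_restrict) simp
  then show ?thesis
    by (simp add: lebesgue_pow_def translate_def[abs_def])
qed

text \<open>
  A product of translation invariant measures is translation invariant, as one sees on boxes, which
  determine the product measure.
\<close>

lemma distr_translate: "distr (lebesgue_pow d) (lebesgue_pow d) (translate d h) = lebesgue_pow d"
proof -
  interpret product_sigma_finite "\<lambda>_::nat. lborel :: real measure" by standard
  have "distr (lebesgue_pow d) (lebesgue_pow d) (translate d h) = Pi\<^sub>M {..<d} (\<lambda>_. lborel)"
  proof (rule PiM_eqI)
    fix A :: "nat \<Rightarrow> real set" assume A: "\<And>i. i \<in> {..<d} \<Longrightarrow> A i \<in> sets lborel"
    have lbs: "emeasure lborel ((\<lambda>x. x + c) -` X) = emeasure lborel X"
      if "X \<in> sets lborel" for X and c :: real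
    proof -
      have "emeasure lborel X = emeasure (distr lborel borel ((+) c)) X"
        by (simp add: lborel_distr_plus)
      also have "\<dots> = emeasure lborel ((+) c -` X)"
        using that by (subst emeasure_distr) auto
      also have "(+) c -` X = (\<lambda>x. x + c) -` X" by (auto simp: add.commute)
      finally show ?thesis by simp
    qed
    have m: "(\<lambda>x. x + h i) -` A i \<in> sets lborel" if "i < d" for i
    proof -
      have "(\<lambda>x::real. x + h i) -` A i \<inter> space borel \<in> sets borel"
        by (rule measurable_sets[of "\<lambda>x::real. x + h i" borel borel]) (use A that in auto)
      then show ?thesis by simp
    qed
    have "emeasure (distr (lebesgue_pow d) (lebesgue_pow d) (translate d h)) (Pi\<^sub>E {..<d} A) =
       emeasure (lebesgue_pow d) (translate d h -` (Pi\<^sub>E {..<d} A) \<inter> space (lebesgue_pow d))"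
      using sets_PiM_I_finite[of "{..<d}" A "\<lambda>_. lborel", OF finite_lessThan A]
      by (intro emeasure_distr translate_measurable) (simp add: lebesgue_pow_def)
    also have "translate d h -` (Pi\<^sub>E {..<d} A) \<inter> space (lebesgue_pow d) =
       Pi\<^sub>E {..<d} (\<lambda>i. (\<lambda>x. x + h i) -` A i)"
      by (auto simp: translate_def lebesgue_pow_def space_PiM PiE_iff)
    also have "emeasure (lebesgue_pow d) \<dots> = (\<Prod>i<d. emeasure lborel ((\<lambda>x. x + h i) -` A i))"
      unfolding lebesgue_pow_def by (rule emeasure_PiM) (use m in auto)
    also have "\<dots> = (\<Prod>i<d. emeasure lborel (A i))"
      by (rule prod.cong) (use A lbs in auto)
    finally show "emeasure (distr (lebesgue_pow d) (lebesgue_pow d) (translate d h)) (Pi\<^sub>E {..<d} A) =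
       (\<Prod>i<d. emeasure lborel (A i))" .
  qed (auto simp: lebesgue_pow_def)
  then show ?thesis by (simp add: lebesgue_pow_def)
qed

lemma nn_integral_translate:
  assumes "f \<in> borel_measurable (lebesgue_pow d)"
  shows "(\<integral>\<^sup>+x. f (translate d h x) \<partial>lebesgue_pow d) = (\<integral>\<^sup>+x. f x \<partial>lebesgue_pow d)"
  using nn_integral_distr[of "translate d h" "lebesgue_pow d" "lebesgue_pow d" f] assms
  by (simp add: distr_translate)

lemma integral_translate:
  fixes f :: "(nat \<Rightarrow> real) \<Rightarrow> real"
  assumes "f \<in> borel_measurable (lebesgue_pow d)"
  shows "(\<integral>x. f (translate d h x) \<partial>lebesgue_pow d) = (\<integral>x. f x \<partial>lebesgue_pow d)"
  using integral_distr[of "translate d h" "lebesgue_pow d" "lebesgue_pow d" f] assms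
  by (simp add: distr_translate)

definition quad_pos_def :: "nat \<Rightarrow> (nat \<Rightarrow> nat \<Rightarrow> real) \<Rightarrow> bool" where
  "quad_pos_def d B \<longleftrightarrow>
     (\<forall>i<d. \<forall>j<d. B i j = B j i) \<and> (\<forall>x. (\<exists>i<d. x i \<noteq> 0) \<longrightarrow> 0 < quad d B x)"

lemma quad_Suc:
  assumes "\<forall>i\<le>d. \<forall>j\<le>d. B i j = B j i"
  shows "quad (Suc d) B x = quad d B x + 2 * x d * (\<Sum>i<d. B i d * x i) + B d d * (x d)\<^sup>2"
proof -
  have "(\<Sum>j<d. B d j * x d * x j) = x d * (\<Sum>i<d. B i d * x i)"
    unfolding sum_distrib_left by (rule sum.cong) (use assms in \<open>auto simp: ac_simps\<close>)
  moreover have "(\<Sum>i<d. B i d * x i * x d) = x d * (\<Sum>i<d. B i d * x i)"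
    unfolding sum_distrib_left by (rule sum.cong) (auto simp: ac_simps)
  ultimately show ?thesis
    by (simp add: quad_def sum.distrib power2_eq_square algebra_simps)
qed

lemma quad_cong: "(\<And>i. i < d \<Longrightarrow> x i = y i) \<Longrightarrow> quad d B x = quad d B y"
  unfolding quad_def by (intro sum.cong refl) auto

text \<open>
  The matrix of the form that remains after the last variable has been minimised out.
\<close>

definition schur_complement :: "nat \<Rightarrow> (nat \<Rightarrow> nat \<Rightarrow> real) \<Rightarrow> nat \<Rightarrow> nat \<Rightarrow> real" where
  "schur_complement d B i j = B i j - B i d * B j d / B d d"

lemma quad_schur_complement:
  "quad d (schur_complement d B) x = quad d B x - (\<Sum>i<d. B i d * x i)\<^sup>2 / B d d"
proof -
  have "(\<Sum>i<d. B i d * x i)\<^sup>2 / B d d = (\<Sum>i<d. \<Sum>j<d. B i d * B j d / B d d * x i * x j)"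
    unfolding power2_eq_square sum_product sum_divide_distrib
    by (intro sum.cong refl) (simp add: field_simps)
  then show ?thesis
    unfolding quad_def schur_complement_def by (simp add: sum_subtractf left_diff_distrib)
qed

lemma quad_complete_square:
  assumes "\<forall>i\<le>d. \<forall>j\<le>d. B i j = B j i" "B d d > 0"
  shows "quad (Suc d) B x =
    quad d (schur_complement d B) x + B d d * (x d + (\<Sum>i<d. B i d * x i) / B d d)\<^sup>2"
  using assms(2) unfolding quad_Suc[OF assms(1)] quad_schur_complement
  by (simp add: power2_eq_square field_simps)

lemma quad_pos_def_last: 
  assumes "quad_pos_def (Suc d) B" shows "0 < B d d"
proof -
  define x :: "nat \<Rightarrow> real" where "x = (\<lambda>i. if i = d then 1 else 0)"
  have "0 < quad (Suc d) B x"
    using assms unfolding quad_pos_def_def x_def by auto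
  also have "quad (Suc d) B x = B d d"
    unfolding quad_def x_def by (simp add: if_distrib cong: if_cong)
  finally show ?thesis .
qed

lemma quad_pos_def_schur_complement:
  assumes "quad_pos_def (Suc d) B"
  shows "quad_pos_def d (schur_complement d B)"
  unfolding quad_pos_def_def
proof (intro conjI allI impI)
  have sym: "\<forall>i\<le>d. \<forall>j\<le>d. B i j = B j i"
    using assms by (auto simp: quad_pos_def_def)
  fix i j assume "i < d" "j < d"
  then show "schur_complement d B i j = schur_complement d B j i"
    using sym unfolding schur_complement_def by (simp add: mult.commute)
next
  have sym: "\<forall>i\<le>d. \<forall>j\<le>d. B i j = B j i"
    using assms by (auto simp: quad_pos_def_def)
  fix x :: "nat \<Rightarrow> real" assume x: "\<exists>i<d. x i \<noteq> 0"
  \<comment> \<open>The last coordinate at which the completed square vanishes.\<close>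
  define y where "y = x(d := - (\<Sum>i<d. B i d * x i) / B d d)"
  have "0 < quad (Suc d) B y"
    using assms x unfolding quad_pos_def_def y_def
    by (metis fun_upd_other less_SucI nat_neq_iff)
  also have "\<dots> = quad d (schur_complement d B) y"
    using quad_complete_square[OF sym quad_pos_def_last[OF assms], of y]
    by (simp add: y_def)
  also have "\<dots> = quad d (schur_complement d B) x"
    by (rule quad_cong) (simp add: y_def)
  finally show "0 < quad d (schur_complement d B) x" .
qed

text \<open>
  One step of block Gaussian elimination: subtracting multiples of the last row clears the last
  column above the pivot \<open>B d d\<close>.
\<close>

lemma det_schur_complement:
  assumes "\<forall>i\<le>d. \<forall>j\<le>d. B i j = B j i" "B d d > (0::real)"
  shows "Determinant.det (mat (Suc d) (Suc d) (\<lambda>(i, j). B i j)) =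
    B d d * Determinant.det (mat d d (\<lambda>(i, j). schur_complement d B i j))"
proof -
  define X where "X = mat d d (\<lambda>(i, j). schur_complement d B i j)"
  define u where "u = mat d 1 (\<lambda>(i, j). B i d / B d d)"
  define r where "r = mat 1 d (\<lambda>(i, j). B d j)"
  define e where "e = mat 1 1 (\<lambda>(i, j). B d d)"
  define U where "U = four_block_mat (1\<^sub>m d) u (0\<^sub>m 1 d) (1\<^sub>m 1)"
  define V where "V = four_block_mat X (0\<^sub>m d 1) r e"
  have c: "X \<in> carrier_mat d d" "u \<in> carrier_mat d 1" "r \<in> carrier_mat 1 d" "e \<in> carrier_mat 1 1"
    by (auto simp: X_def u_def r_def e_def)
  have U: "U \<in> carrier_mat (Suc d) (Suc d)" and V: "V \<in> carrier_mat (Suc d) (Suc d)"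
    unfolding U_def V_def by (auto simp: X_def u_def r_def e_def)
  have "U * V = four_block_mat (1\<^sub>m d * X + u * r) (1\<^sub>m d * 0\<^sub>m d 1 + u * e)
     (0\<^sub>m 1 d * X + 1\<^sub>m 1 * r) (0\<^sub>m 1 d * 0\<^sub>m d 1 + 1\<^sub>m 1 * e)"
    unfolding U_def V_def
    by (rule mult_four_block_mat[OF one_carrier_mat c(2) zero_carrier_mat one_carrier_mat
          c(1) zero_carrier_mat c(3) c(4)])
  also have "\<dots> = mat (Suc d) (Suc d) (\<lambda>(i, j). B i j)"
    using assms
    by (intro eq_matI)
       (auto simp: X_def u_def r_def e_def schur_complement_def scalar_prod_def less_Suc_eq)
  finally have UV: "U * V = mat (Suc d) (Suc d) (\<lambda>(i, j). B i j)" .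
  have "Determinant.det U = 1"
    using det_four_block_mat_lower_left_zero[OF one_carrier_mat c(2) refl one_carrier_mat]
    by (simp add: U_def)
  moreover have "Determinant.det e = B d d"
    by (simp add: e_def det_single)
  then have "Determinant.det V = Determinant.det X * B d d"
    using det_four_block_mat_upper_right_zero[OF c(1) refl c(3) c(4)] by (simp add: V_def)
  ultimately show ?thesis
    unfolding UV[symmetric] det_mult[OF U V] X_def by simp
qed

lemma nn_integral_exp_square:
  assumes "\<beta> > 0"
  shows "(\<integral>\<^sup>+y. ennreal (exp (- (\<beta> * (y + c)\<^sup>2) / 2)) \<partial>lborel) = ennreal (sqrt (2 * pi / \<beta>))"
proof -
  have *: "exp (- (\<beta> * (y + c)\<^sup>2) / 2) = sqrt (2 * pi / \<beta>) * normal_density (- c) (1 / sqrt \<beta>) y" for y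
    using assms by (simp add: normal_density_def real_sqrt_divide power_divide field_simps)
  have "(\<integral>\<^sup>+y. ennreal (normal_density (- c) (1 / sqrt \<beta>) y) \<partial>lborel) = 1"
    using assms by (subst nn_integral_eq_integral) auto
  then show ?thesis
    unfolding * using assms by (simp add: ennreal_mult' nn_integral_cmult)
qed

text \<open>
  Induction on the dimension. Completing the square in the last variable splits off a
  one-dimensional Gaussian integral with parameter \<open>B d d\<close> and leaves the Schur complement; the
  determinants factor in the same way.
\<close>

lemma gaussian_integral:
  assumes "quad_pos_def d B"
  shows "0 < Determinant.det (mat d d (\<lambda>(i, j). B i j)) \<and>
    (\<integral>\<^sup>+x. ennreal (exp (- quad d B x / 2)) \<partial>lebesgue_pow d) =
      ennreal (sqrt ((2 * pi) ^ d / Determinant.det (mat d d (\<lambda>(i, j). B i j))))"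
  using assms
proof (induction d arbitrary: B)
  case 0
  interpret product_sigma_finite "\<lambda>_::nat. lborel :: real measure" by standard
  have "(\<integral>\<^sup>+x. ennreal (exp (- quad 0 B x / 2)) \<partial>lebesgue_pow 0) = 1"
    unfolding lebesgue_pow_def quad_def by (simp add: PiM_empty)
  then show ?case by simp
next
  case (Suc d)
  let ?X = "schur_complement d B"
  have sym: "\<forall>i\<le>d. \<forall>j\<le>d. B i j = B j i"
    using Suc.prems by (auto simp: quad_pos_def_def)
  note pos = quad_pos_def_last[OF Suc.prems]
  note IH = Suc.IH[OF quad_pos_def_schur_complement[OF Suc.prems]]
  have "(\<integral>\<^sup>+x. ennreal (exp (- quad (Suc d) B x / 2)) \<partial>lebesgue_pow (Suc d)) =
     (\<integral>\<^sup>+x. \<integral>\<^sup>+y. ennreal (exp (- quad d ?X x / 2)) *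
        ennreal (exp (- (B d d * (y + (\<Sum>i<d. B i d * x i) / B d d)\<^sup>2) / 2)) \<partial>lborel \<partial>lebesgue_pow d)"
    unfolding ennreal_mult'[symmetric, OF exp_ge_zero] exp_add[symmetric]
  proof (subst nn_integral_lebesgue_pow_Suc, measurable, intro nn_integral_cong arg_cong[of _ _ ennreal] arg_cong[of _ _ exp])
    fix x y
    have "quad d ?X (x(d := y)) = quad d ?X x" by (rule quad_cong) simp
    then show "- quad (Suc d) B (x(d := y)) / 2 = - quad d ?X x / 2 + - (B d d * (y + (\<Sum>i<d. B i d * x i) / B d d)\<^sup>2) / 2"
      by (simp add: quad_complete_square[OF sym pos])
  qed
  also have "\<dots> = (\<integral>\<^sup>+x. ennreal (exp (- quad d ?X x / 2)) * ennreal (sqrt (2 * pi / B d d)) \<partial>lebesgue_pow d)"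
    by (subst nn_integral_cmult) (simp_all only: nn_integral_exp_square[OF pos], simp)
  also have "\<dots> = ennreal (sqrt ((2 * pi) ^ d / Determinant.det (mat d d (\<lambda>(i, j). ?X i j)))) * ennreal (sqrt (2 * pi / B d d))"
    using IH by (subst nn_integral_multc) auto
  also have "\<dots> = ennreal (sqrt ((2 * pi) ^ Suc d / Determinant.det (mat (Suc d) (Suc d) (\<lambda>(i, j). B i j))))"
    unfolding det_schur_complement[OF sym pos]
    using IH pos by (simp add: ennreal_mult'[symmetric] real_sqrt_mult real_sqrt_divide mult_ac)
  finally show ?case
    unfolding det_schur_complement[OF sym pos] using IH pos by simp
qed

section \<open>The smallest eigenvalue and the inverse of a covariance matrix\<close>

lemma quad_smult: "quad d A (\<lambda>i. c * x i) = c\<^sup>2 * quad d A x"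
  unfolding quad_def sum_distrib_left
  by (intro sum.cong refl) (simp add: power2_eq_square)

lemma quad_eq_sum: "quad d A x = (\<Sum>i<d. x i * (\<Sum>j<d. A i j * x j))"
  unfolding quad_def sum_distrib_left by (intro sum.cong refl) simp

lemma sum_delta_mult:
  fixes k d :: nat
  shows "k < d \<Longrightarrow> (\<Sum>i<d. (if i = k then c else 0) * f i) = (c * f k :: real)"
  by (simp add: if_distrib[of "\<lambda>u. u * _"] cong: if_cong)

lemma sum_delta_square:
  fixes k d :: nat and c :: real
  shows "k < d \<Longrightarrow> (\<Sum>i<d. (if i = k then c else 0)\<^sup>2) = c\<^sup>2"
  unfolding power2_eq_square by (simp add: sum_delta_mult)

lemma quad_add:
  assumes "\<forall>i<d. \<forall>j<d. A i j = A j i"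
  shows "quad d A (\<lambda>i. x i + y i) = quad d A x + 2 * (\<Sum>i<d. y i * (\<Sum>j<d. A i j * x j)) + quad d A y"
proof -
  have "(\<Sum>i<d. x i * (\<Sum>j<d. A i j * y j)) = (\<Sum>i<d. \<Sum>j<d. x i * (A i j * y j))"
    by (simp add: sum_distrib_left)
  also have "\<dots> = (\<Sum>j<d. \<Sum>i<d. x i * (A i j * y j))"
    by (rule sum.swap)
  also have "\<dots> = (\<Sum>j<d. y j * (\<Sum>i<d. A j i * x i))"
    unfolding sum_distrib_left using assms by (intro sum.cong refl) simp
  finally show ?thesis
    unfolding quad_eq_sum by (simp add: sum.distrib algebra_simps)
qed

lemma quad_unit: "k < d \<Longrightarrow> quad d A (\<lambda>i. if i = k then c else 0) = c\<^sup>2 * A k k"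
  unfolding quad_eq_sum by (subst sum_delta_mult) (auto simp: power2_eq_square if_distrib cong: if_cong)

lemma linear_coefficient_zero:
  fixes c e :: real
  assumes "\<And>t. 0 \<le> 2 * t * c + t\<^sup>2 * e"
  shows "c = 0"
proof (rule ccontr)
  assume "c \<noteq> 0"
  \<comment> \<open>At \<open>t = - c / m\<close> the linear term outweighs the quadratic one.\<close>
  define m where "m = \<bar>e\<bar> + 1"
  have m: "m > 0" "e - 2 * m < 0" unfolding m_def by auto
  have "2 * (- c / m) * c + (- c / m)\<^sup>2 * e = c\<^sup>2 / m\<^sup>2 * (e - 2 * m)"
    using m by (simp add: power2_eq_square field_simps)
  moreover have "c\<^sup>2 / m\<^sup>2 * (e - 2 * m) < 0"
    using m \<open>c \<noteq> 0\<close> by (intro mult_pos_neg) auto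
  ultimately show False using assms[of "- c / m"] by linarith
qed

text \<open>
  The unit sphere of \<open>d\<close>-space sits inside \<open>nat \<Rightarrow> real\<close> as the points that vanish beyond \<open>d\<close>; there
  it is a closed subset of a product of compact sets, hence compact by Tychonoff's theorem.
\<close>

lemma compact_coordinate_sphere:
  "compact {x :: nat \<Rightarrow> real. (\<forall>i. x i \<in> (if i < d then {-1..1} else {0})) \<and> (\<Sum>i<d. (x i)\<^sup>2) = 1}"
proof -
  have "compactin (product_topology (\<lambda>i. euclidean) UNIV)
      (PiE UNIV (\<lambda>i. if i < d then {-1..1::real} else {0}))"
    by (subst compactin_PiE) (auto simp: compactin_euclidean_iff)
  then have c: "compact (PiE UNIV (\<lambda>i. if i < d then {-1..1::real} else {0}))"
    by (simp add: euclidean_product_topology compactin_euclidean_iff)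
  have "continuous_on UNIV (\<lambda>x :: nat \<Rightarrow> real. \<Sum>i<d. (x i)\<^sup>2)"
    by (intro continuous_intros continuous_on_product_coordinates)
  then have "closed {x :: nat \<Rightarrow> real. (\<Sum>i<d. (x i)\<^sup>2) = 1}"
    by (rule closed_Collect_eq) simp
  from compact_Int_closed[OF c this] show ?thesis
    by (rule back_subst[of compact]) (auto simp: PiE_def Pi_def)
qed

text \<open>
  The minimum of the quadratic form on the unit sphere is attained, and there the first variation
  vanishes, which says that the minimiser is an eigenvector and the minimum its eigenvalue. This
  provides the part of the spectral theorem for symmetric matrices that links the smallest eigenvalue
  to the quadratic form.
\<close>

lemma rayleigh_minimiser:
  assumes sym: "\<forall>i<d. \<forall>j<d. A i j = A j i" and "d > 0"
  obtains x \<mu> where "\<exists>i<d. x i \<noteq> 0" "\<And>i. i < d \<Longrightarrow> (\<Sum>j<d. A i j * x j) = \<mu> * x i"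
    "\<And>y. \<mu> * (\<Sum>i<d. (y i)\<^sup>2) \<le> quad d A y"
proof -
  define K where
    "K = {x :: nat \<Rightarrow> real. (\<forall>i. x i \<in> (if i < d then {-1..1} else {0})) \<and> (\<Sum>i<d. (x i)\<^sup>2) = 1}"
  have "(\<lambda>i. if i = 0 then 1 else 0) \<in> K"
    using \<open>d > 0\<close> unfolding K_def by (auto simp: sum_delta_square)
  then have ne: "K \<noteq> {}" by auto
  have "continuous_on K (quad d A)"
    unfolding quad_def[abs_def]
    by (intro continuous_intros continuous_on_subset[OF continuous_on_product_coordinates]) auto
  with continuous_attains_inf[OF compact_coordinate_sphere[of d, folded K_def] ne]
  obtain x where x: "x \<in> K" and min: "\<And>y. y \<in> K \<Longrightarrow> quad d A x \<le> quad d A y" by blast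
  define \<mu> where "\<mu> = quad d A x"
  have one: "(\<Sum>i<d. (x i)\<^sup>2) = 1" using x by (auto simp: K_def)
  have ge: "\<mu> * (\<Sum>i<d. (y i)\<^sup>2) \<le> quad d A y" for y
  proof (cases "(\<Sum>i<d. (y i)\<^sup>2) = 0")
    case True
    then have "\<forall>i<d. y i = 0" by (simp add: sum_nonneg_eq_0_iff)
    then have "quad d A y = 0" unfolding quad_def by auto
    then show ?thesis using True by simp
  next
    case False
    define s where "s = (\<Sum>i<d. (y i)\<^sup>2)"
    have s: "s > 0" using False unfolding s_def by (simp add: sum_nonneg order_less_le)
    define z where "z = (\<lambda>i. if i < d then (1 / sqrt s) * y i else 0)"
    have z1: "(\<Sum>i<d. (z i)\<^sup>2) = 1"
    proof -
      have "(\<Sum>i<d. (z i)\<^sup>2) = (\<Sum>i<d. (y i)\<^sup>2 / s)"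
        using s by (intro sum.cong refl) (simp add: z_def power_mult_distrib power_divide)
      also have "\<dots> = 1" using s by (simp add: sum_divide_distrib[symmetric] s_def)
      finally show ?thesis .
    qed
    have "z i \<in> {-1..1}" if "i < d" for i
    proof -
      have "(z i)\<^sup>2 \<le> (\<Sum>i<d. (z i)\<^sup>2)" by (rule member_le_sum) (use that in auto)
      then have "\<bar>z i\<bar> \<le> 1" using z1 by (simp add: abs_square_le_1)
      then show ?thesis by (simp add: abs_le_iff)
    qed
    moreover have "z i = 0" if "\<not> i < d" for i using that by (simp add: z_def)
    ultimately have "z \<in> K" using z1 by (simp add: K_def)
    from min[OF this] have "\<mu> \<le> quad d A z" by (simp add: \<mu>_def)
    also have "\<dots> = quad d A (\<lambda>i. (1 / sqrt s) * y i)" by (rule quad_cong) (simp add: z_def)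
    also have "\<dots> = quad d A y / s" unfolding quad_smult using s by (simp add: power_divide)
    finally show ?thesis using s by (simp add: s_def[symmetric] pos_le_divide_eq)
  qed
  show ?thesis
  proof (rule that)
    show "\<exists>i<d. x i \<noteq> 0"
    proof (rule ccontr)
      assume "\<not> (\<exists>i<d. x i \<noteq> 0)"
      then have "(\<Sum>i<d. (x i)\<^sup>2) = 0" by simp
      with one show False by simp
    qed
    show "\<mu> * (\<Sum>i<d. (y i)\<^sup>2) \<le> quad d A y" for y by (rule ge)
    fix k assume k: "k < d"
    define L where "L = (\<Sum>j<d. A k j * x j)"
    have "L - \<mu> * x k = 0"
    proof (rule linear_coefficient_zero)
      fix t :: real
      let ?e = "\<lambda>i. if i = k then t else 0"
      have "(\<Sum>i<d. (x i + ?e i)\<^sup>2) = (\<Sum>i<d. (x i)\<^sup>2 + ?e i * (2 * x i + t))"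
        by (intro sum.cong refl) (simp add: power2_eq_square algebra_simps)
      also have "\<dots> = 1 + t * (2 * x k + t)"
        using k by (simp add: sum.distrib sum_delta_mult one)
      finally have "\<mu> * (1 + t * (2 * x k + t)) \<le> \<mu> + 2 * (t * L) + t\<^sup>2 * A k k"
        using ge[of "\<lambda>i. x i + ?e i"] k
        by (simp add: quad_add[OF sym] quad_unit sum_delta_mult \<mu>_def L_def)
      then show "0 \<le> 2 * t * (L - \<mu> * x k) + t\<^sup>2 * (A k k - \<mu>)"
        by (simp add: power2_eq_square algebra_simps)
    qed
    then show "(\<Sum>j<d. A k j * x j) = \<mu> * x k" by (simp add: L_def)
  qed
qed

lemma quad_eq_scalar_prod:
  "S \<in> carrier_mat d d \<Longrightarrow> vec d x \<bullet> (S *\<^sub>v vec d x) = quad d (\<lambda>i j. S $$ (i, j)) x"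
  by (simp add: quad_eq_sum scalar_prod_def lessThan_atLeast0)

lemma sym_pos_def_quad:
  assumes "sym_pos_def d S"
  shows "quad_pos_def d (\<lambda>i j. S $$ (i, j))"
  unfolding quad_pos_def_def
proof (intro conjI allI impI)
  have S: "S \<in> carrier_mat d d" "transpose_mat S = S" using assms by (auto simp: sym_pos_def_def)
  fix i j assume "i < d" "j < d"
  with S show "S $$ (i, j) = S $$ (j, i)" by (metis carrier_matD index_transpose_mat(1))
next
  have S: "S \<in> carrier_mat d d" using assms by (auto simp: sym_pos_def_def)
  fix x :: "nat \<Rightarrow> real" assume "\<exists>i<d. x i \<noteq> 0"
  then have "vec d x \<noteq> 0\<^sub>v d" by (metis index_vec index_zero_vec(1))
  then have "0 < vec d x \<bullet> (S *\<^sub>v vec d x)"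
    using assms by (simp add: sym_pos_def_def)
  then show "0 < quad d (\<lambda>i j. S $$ (i, j)) x"
    by (simp add: quad_eq_scalar_prod[OF S])
qed

lemma eigenvalue_pos:
  assumes "sym_pos_def d S" "eigenvalue S k"
  shows "0 < k"
proof -
  from assms(2) obtain v where "eigenvector S v k" by (auto simp: eigenvalue_def)
  then have v: "v \<in> carrier_vec d" "v \<noteq> 0\<^sub>v d" "S *\<^sub>v v = k \<cdot>\<^sub>v v"
    using assms(1) by (auto simp: eigenvector_def sym_pos_def_def)
  then have "0 < v \<bullet> (k \<cdot>\<^sub>v v)" using assms(1) by (metis sym_pos_def_def)
  also have "v \<bullet> (k \<cdot>\<^sub>v v) = k * (v \<bullet> v)" using v(1) by simp
  finally have "0 < k * (v \<bullet> v)" .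
  moreover have "0 \<le> v \<bullet> v" by (simp add: scalar_prod_def sum_nonneg)
  ultimately show ?thesis by (simp add: zero_less_mult_iff)
qed

text \<open>
  The Rayleigh minimum is an eigenvalue, so it is at least the smallest one. That eigenvalue is itself
  positive, so the square root in \<open>sigma_star\<close> is a genuine one.
\<close>

lemma sigma_star_rayleigh:
  assumes S: "sym_pos_def d S" and d: "d > 0"
  shows "0 < sigma_star S" "(sigma_star S)\<^sup>2 * (\<Sum>i<d. (y i)\<^sup>2) \<le> quad d (\<lambda>i j. S $$ (i, j)) y"
proof -
  have Sc: "S \<in> carrier_mat d d" using S by (auto simp: sym_pos_def_def)
  note q = sym_pos_def_quad[OF S]
  obtain x \<mu> where x: "\<exists>i<d. x i \<noteq> 0"
    and ev: "\<And>i. i < d \<Longrightarrow> (\<Sum>j<d. S $$ (i, j) * x j) = \<mu> * x i"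
    and min: "\<And>y. \<mu> * (\<Sum>i<d. (y i)\<^sup>2) \<le> quad d (\<lambda>i j. S $$ (i, j)) y"
    by (rule rayleigh_minimiser[of d "\<lambda>i j. S $$ (i, j)"]) (use q d in \<open>auto simp: quad_pos_def_def\<close>)
  have "vec d x \<noteq> 0\<^sub>v d" using x by (metis index_vec index_zero_vec(1))
  moreover have "S *\<^sub>v vec d x = \<mu> \<cdot>\<^sub>v vec d x"
    using ev Sc by (intro eq_vecI) (auto simp: scalar_prod_def lessThan_atLeast0)
  ultimately have "eigenvector S (vec d x) \<mu>" using Sc by (auto simp: eigenvector_def)
  then have mu: "\<mu> \<in> spectrum S" by (auto simp: spectrum_def eigenvalue_def)
  have fin: "finite (spectrum S)" by (rule card_finite_spectrum[OF Sc])
  have "Min (spectrum S) \<in> spectrum S" using fin mu by (intro Min_in) auto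
  then have pos: "0 < Min (spectrum S)" using eigenvalue_pos[OF S] by (simp add: spectrum_def)
  then show "0 < sigma_star S" by (simp add: sigma_star_def)
  have "(sigma_star S)\<^sup>2 = Min (spectrum S)" using pos by (simp add: sigma_star_def)
  also have "\<dots> \<le> \<mu>" using fin mu by simp
  finally have "(sigma_star S)\<^sup>2 * (\<Sum>i<d. (y i)\<^sup>2) \<le> \<mu> * (\<Sum>i<d. (y i)\<^sup>2)"
    by (rule mult_right_mono) (simp add: sum_nonneg)
  with min[of y] show "(sigma_star S)\<^sup>2 * (\<Sum>i<d. (y i)\<^sup>2) \<le> quad d (\<lambda>i j. S $$ (i, j)) y"
    by linarith
qed

definition precision :: "real mat \<Rightarrow> nat \<Rightarrow> nat \<Rightarrow> real" where
  "precision S i j = the (mat_inverse S) $$ (i, j)"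

lemma sym_pos_def_inverse:
  assumes S: "sym_pos_def d S"
  shows "the (mat_inverse S) \<in> carrier_mat d d" "S * the (mat_inverse S) = 1\<^sub>m d"
    "the (mat_inverse S) * S = 1\<^sub>m d" "transpose_mat (the (mat_inverse S)) = the (mat_inverse S)"
proof -
  have Sc: "S \<in> carrier_mat d d" and St: "transpose_mat S = S"
    using S by (auto simp: sym_pos_def_def)
  have "\<not> (\<exists>v. v \<in> carrier_vec d \<and> v \<noteq> 0\<^sub>v d \<and> S *\<^sub>v v = 0\<^sub>v d)"
  proof
    assume "\<exists>v. v \<in> carrier_vec d \<and> v \<noteq> 0\<^sub>v d \<and> S *\<^sub>v v = 0\<^sub>v d"
    then obtain v where v: "v \<in> carrier_vec d" "v \<noteq> 0\<^sub>v d" "S *\<^sub>v v = 0\<^sub>v d" by auto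
    then have "0 < v \<bullet> 0\<^sub>v d" using S by (metis sym_pos_def_def)
    then show False using v(1) by simp
  qed
  then have "Determinant.det S \<noteq> 0" using det_0_iff_vec_prod_zero_field[OF Sc] by blast
  then have "S \<in> Units (ring_mat TYPE(real) d ())" by (rule det_non_zero_imp_unit[OF Sc])
  then obtain T where "mat_inverse S = Some T" using mat_inverse(1)[OF Sc, of "()"] by (cases "mat_inverse S") auto
  with mat_inverse(2)[OF Sc this] show T: "the (mat_inverse S) \<in> carrier_mat d d"
    and ST: "S * the (mat_inverse S) = 1\<^sub>m d" and TS: "the (mat_inverse S) * S = 1\<^sub>m d" by auto
  let ?T = "the (mat_inverse S)"
  have Tt: "transpose_mat ?T \<in> carrier_mat d d" using T by simp
  have "transpose_mat ?T * S = transpose_mat (S * ?T)" using transpose_mult[OF Sc T] St by simp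
  also have "\<dots> = 1\<^sub>m d" by (simp add: ST)
  finally have "transpose_mat ?T * S = 1\<^sub>m d" .
  then have "transpose_mat ?T * (S * ?T) = ?T"
    using assoc_mult_mat[OF Tt Sc T] T by simp
  then show "transpose_mat ?T = ?T" using ST Tt by simp
qed

lemma precision_inverse:
  assumes "sym_pos_def d S" "i < d" "j < d"
  shows "(\<Sum>k<d. S $$ (i, k) * precision S k j) = (if i = j then 1 else 0)"
proof -
  note T = sym_pos_def_inverse[OF assms(1)]
  have Sc: "S \<in> carrier_mat d d" using assms(1) by (auto simp: sym_pos_def_def)
  have "(S * the (mat_inverse S)) $$ (i, j) = (\<Sum>k<d. S $$ (i, k) * precision S k j)"
    using T(1) Sc assms(2,3) by (simp add: scalar_prod_def lessThan_atLeast0 precision_def)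
  then show ?thesis using T(2) assms(2,3) by simp
qed

lemma precision_sym:
  assumes "sym_pos_def d S" "i < d" "j < d"
  shows "precision S i j = precision S j i"
  using sym_pos_def_inverse(1,4)[OF assms(1)] assms(2,3)
  unfolding precision_def by (metis carrier_matD index_transpose_mat(1))

text \<open>
  \<open>S (B x) = x\<close>, written out in coordinates.
\<close>

lemma precision_solve:
  assumes "sym_pos_def d S" "i < d"
  shows "(\<Sum>k<d. S $$ (i, k) * (\<Sum>j<d. precision S k j * x j)) = x i"
proof -
  have "(\<Sum>k<d. S $$ (i, k) * (\<Sum>j<d. precision S k j * x j)) =
      (\<Sum>k<d. \<Sum>j<d. S $$ (i, k) * precision S k j * x j)"
    by (simp add: sum_distrib_left mult.assoc)
  also have "\<dots> = (\<Sum>j<d. \<Sum>k<d. S $$ (i, k) * precision S k j * x j)" by (rule sum.swap)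
  also have "\<dots> = (\<Sum>j<d. (if j = i then 1 else 0) * x j)"
    using precision_inverse[OF assms] by (intro sum.cong refl) (auto simp: sum_distrib_right[symmetric])
  also have "\<dots> = x i" using assms(2) by (simp add: sum_delta_mult)
  finally show ?thesis .
qed

lemma quad_precision:
  assumes "sym_pos_def d S"
  shows "quad d (precision S) x = quad d (\<lambda>i j. S $$ (i, j)) (\<lambda>k. \<Sum>j<d. precision S k j * x j)"
  unfolding quad_eq_sum using precision_solve[OF assms]
  by (intro sum.cong refl) (auto simp: mult.commute)

lemma precision_pos_def:
  assumes S: "sym_pos_def d S"
  shows "quad_pos_def d (precision S)"
  unfolding quad_pos_def_def
proof (intro conjI allI impI)
  fix i j assume "i < d" "j < d"
  then show "precision S i j = precision S j i" by (rule precision_sym[OF S])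
next
  fix x :: "nat \<Rightarrow> real" assume "\<exists>i<d. x i \<noteq> 0"
  then obtain i where i: "i < d" "x i \<noteq> 0" by auto
  have "\<exists>k<d. (\<Sum>j<d. precision S k j * x j) \<noteq> 0"
  proof (rule ccontr)
    assume "\<not> ?thesis"
    then have "(\<Sum>k<d. S $$ (i, k) * (\<Sum>j<d. precision S k j * x j)) = 0" by simp
    with i precision_solve[OF S i(1), of x] show False by simp
  qed
  then show "0 < quad d (precision S) x"
    unfolding quad_precision[OF S] using sym_pos_def_quad[OF S] by (simp add: quad_pos_def_def)
qed

lemma sigma_star_le_1:
  assumes S: "sym_pos_def d S" and d: "d > 0" and diag: "S $$ (0, 0) = 1"
  shows "sigma_star S \<le> 1"
proof -
  have "(sigma_star S)\<^sup>2 * 1 \<le> 1"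
    using sigma_star_rayleigh(2)[OF S d, of "\<lambda>i. if i = 0 then 1 else 0"] d diag
    by (simp add: quad_unit sum_delta_square)
  then show ?thesis using sigma_star_rayleigh(1)[OF S d] by (simp add: abs_square_le_1)
qed

text \<open>
  For the column \<open>x = B e\<close> of the inverse, with \<open>e\<close> the unit vector of the coordinate \<open>j\<close>, the Rayleigh
  bound reads \<open>\<sigma>\<^sup>2 \<bar>x\<bar>\<^sup>2 \<le> \<langle>x, S x\<rangle> = B j j\<close>. As \<open>B j j\<close> is an entry of \<open>x\<close>, this first gives \<open>B j j \<le> 1 / \<sigma>\<^sup>2\<close>
  and then \<open>\<bar>x\<bar> \<le> 1 / \<sigma>\<^sup>2\<close>.
\<close>

lemma precision_bound:
  assumes S: "sym_pos_def d S" and ij: "i < d" "j < d"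
  shows "\<bar>precision S i j\<bar> \<le> 1 / (sigma_star S)\<^sup>2"
proof -
  let ?P = "precision S"
  have d: "d > 0" using ij by simp
  note \<sigma> = sigma_star_rayleigh(1)[OF S d]
  define q where "q = (\<Sum>i<d. (?P i j)\<^sup>2)"
  have col: "(sigma_star S)\<^sup>2 * q \<le> ?P j j"
  proof -
    have "?P j j = quad d ?P (\<lambda>i. if i = j then 1 else 0)" using ij by (simp add: quad_unit)
    also have "\<dots> = quad d (\<lambda>i j. S $$ (i, j)) (\<lambda>i. ?P i j)"
      unfolding quad_precision[OF S]
      by (rule quad_cong) (use ij in \<open>simp add: if_distrib cong: if_cong\<close>)
    finally show ?thesis using sigma_star_rayleigh(2)[OF S d, of "\<lambda>i. ?P i j"] by (simp add: q_def)
  qed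
  have sq: "(?P i j)\<^sup>2 \<le> q" if "i < d" for i
    unfolding q_def by (rule member_le_sum) (use that in auto)
  let ?s = "(sigma_star S)\<^sup>2"
  have s: "?s > 0" using \<sigma> by simp
  have "?s * (?P j j)\<^sup>2 \<le> ?s * q" using sq[OF ij(2)] s by simp
  then have A: "?s * (?P j j)\<^sup>2 \<le> ?P j j" using col by linarith
  then have "?P j j * (?s * ?P j j) \<le> ?P j j * 1" by (simp add: power2_eq_square mult_ac)
  moreover have "0 \<le> ?P j j" using A s
    by (meson dual_order.trans less_imp_le mult_nonneg_nonneg zero_le_power2)
  ultimately have "?s * ?P j j \<le> 1"
    by (cases "?P j j = 0") auto
  then have "?s * (?s * q) \<le> 1" using col s
    by (meson mult_left_mono less_imp_le order_trans)
  then have "?s * (?s * (?P i j)\<^sup>2) \<le> 1" using sq[OF ij(1)] s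
    by (meson mult_left_mono less_imp_le order_trans)
  then have "(?s * ?P i j)\<^sup>2 \<le> 1" by (simp add: power2_eq_square mult_ac)
  then have "\<bar>?s * ?P i j\<bar> \<le> 1" by (simp add: abs_square_le_1)
  then show ?thesis using s by (simp add: abs_mult field_simps)
qed

lemma precision_gaussian_integral:
  assumes S: "sym_pos_def d S"
  shows "0 < Determinant.det S"
    "(\<integral>\<^sup>+x. ennreal (exp (- quad d (precision S) x / 2)) \<partial>lebesgue_pow d) =
       ennreal (sqrt ((2 * pi) ^ d * Determinant.det S))"
proof -
  note T = sym_pos_def_inverse[OF S]
  have Sc: "S \<in> carrier_mat d d" using S by (auto simp: sym_pos_def_def)
  have "mat d d (\<lambda>(i, j). precision S i j) = the (mat_inverse S)"
    using T(1) by (intro eq_matI) (auto simp: precision_def)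
  note G = gaussian_integral[OF precision_pos_def[OF S], unfolded this]
  have 1: "Determinant.det S * Determinant.det (the (mat_inverse S)) = 1"
    using det_mult[OF Sc T(1)] T(2) by simp
  have T0: "0 < Determinant.det (the (mat_inverse S))" using G by simp
  have "0 < Determinant.det S * Determinant.det (the (mat_inverse S))" by (simp add: 1)
  then show "0 < Determinant.det S" using T0 by (rule zero_less_mult_pos2)
  then have "(2 * pi) ^ d / Determinant.det (the (mat_inverse S)) = (2 * pi) ^ d * Determinant.det S"
    using 1 T0 by (simp add: field_simps)
  then show "(\<integral>\<^sup>+x. ennreal (exp (- quad d (precision S) x / 2)) \<partial>lebesgue_pow d) =
       ennreal (sqrt ((2 * pi) ^ d * Determinant.det S))" using G by simp
qed

section \<open>Exponential moments of a Gaussian density\<close>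

definition bump :: "nat \<Rightarrow> real \<Rightarrow> nat \<Rightarrow> real" where
  "bump k t = (\<lambda>i. if i = k then t else 0)"

lemma sum_bump_mult: "k < d \<Longrightarrow> (\<Sum>i<d. bump k c i * f i) = c * f k"
  unfolding bump_def by (rule sum_delta_mult)

lemma quad_bump: "k < d \<Longrightarrow> quad d A (bump k c) = c\<^sup>2 * A k k"
  unfolding bump_def by (rule quad_unit)

lemma translate_0: "z \<in> space (lebesgue_pow d) \<Longrightarrow> translate d (bump k 0) z = z"
  by (auto simp: lebesgue_pow_def space_PiM translate_def bump_def fun_eq_iff PiE_def extensional_def)

text \<open>
  What the analysis below uses of a centred normal law with unit variances: its precision matrix \<open>B\<close>,
  its covariance matrix \<open>S\<close>, the normalizing constant \<open>N\<close>, and a scale \<open>\<sigma>\<close> that controls the entries of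
  \<open>B\<close>.
\<close>

locale gaussian =
  fixes d :: nat and B S :: "nat \<Rightarrow> nat \<Rightarrow> real" and N \<sigma> :: real
  assumes B_sym: "\<And>i j. i < d \<Longrightarrow> j < d \<Longrightarrow> B i j = B j i"
    and S_B: "\<And>i j. i < d \<Longrightarrow> j < d \<Longrightarrow> (\<Sum>k<d. S i k * B k j) = (if i = j then 1 else 0)"
    and S_diag: "\<And>i. i < d \<Longrightarrow> S i i = 1"
    and N_pos: "0 < N"
    and normalized: "(\<integral>\<^sup>+z. ennreal (exp (- quad d B z / 2)) \<partial>lebesgue_pow d) = ennreal N"
    and \<sigma>_pos: "0 < \<sigma>" and \<sigma>_le_1: "\<sigma> \<le> 1"
    and B_bound: "\<And>i j. i < d \<Longrightarrow> j < d \<Longrightarrow> \<bar>B i j\<bar> \<le> 1 / \<sigma>\<^sup>2"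
begin

definition p :: "(nat \<Rightarrow> real) \<Rightarrow> real" where
  "p z = exp (- quad d B z / 2) / N"

text \<open>
  The functionals \<open>L i z = (B z) i\<close> are the logarithmic derivatives of the density up to sign. Under the
  normal law they have covariance matrix \<open>B\<close>, and \<open>L i\<close> is uncorrelated with every coordinate \<open>z j\<close> other
  than \<open>z i\<close>.
\<close>

definition L :: "nat \<Rightarrow> (nat \<Rightarrow> real) \<Rightarrow> real" where
  "L i z = (\<Sum>j<d. B i j * z j)"

lemma p_pos: "0 < p z"
  using N_pos by (simp add: p_def)

lemma p_nonneg [simp]: "0 \<le> p z"
  using p_pos[of z] by simp

lemma p_measurable [measurable]: "p \<in> borel_measurable (lebesgue_pow d)"
  unfolding p_def[abs_def] by measurable

lemma L_measurable [measurable]: "L i \<in> borel_measurable (lebesgue_pow d)"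
  unfolding L_def[abs_def] by (intro borel_measurable_sum borel_measurable_times) auto

lemma nn_integral_p: "(\<integral>\<^sup>+z. ennreal (p z) \<partial>lebesgue_pow d) = 1"
proof -
  have "(\<integral>\<^sup>+z. ennreal (p z) \<partial>lebesgue_pow d) =
      (\<integral>\<^sup>+z. ennreal (1 / N) * ennreal (exp (- quad d B z / 2)) \<partial>lebesgue_pow d)"
    using N_pos by (intro nn_integral_cong) (simp add: p_def ennreal_mult'[symmetric])
  also have "\<dots> = ennreal (1 / N) * ennreal N"
    using normalized by (subst nn_integral_cmult) simp_all
  also have "\<dots> = 1" using N_pos by (simp add: ennreal_mult'[symmetric])
  finally show ?thesis .
qed

lemma quad_add_L: "quad d B (\<lambda>i. x i + y i) = quad d B x + 2 * (\<Sum>i<d. y i * L i x) + quad d B y"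
  unfolding L_def by (rule quad_add) (use B_sym in auto)

lemma p_translate: "p (translate d h z) = exp (- (\<Sum>i<d. h i * L i z) - quad d B h / 2) * p z"
proof -
  have "quad d B (translate d h z) = quad d B (\<lambda>i. z i + h i)"
    by (rule quad_cong) (simp add: translate_apply)
  then have "quad d B (translate d h z) = quad d B z + 2 * (\<Sum>i<d. h i * L i z) + quad d B h"
    by (simp only: quad_add_L)
  then show ?thesis
    by (simp add: p_def exp_add[symmetric] field_simps)
qed

lemma L_translate: "L i (translate d h z) = L i z + L i h"
  by (simp add: L_def translate_apply distrib_left sum.distrib)

lemma L_bump: "k < d \<Longrightarrow> L i (bump k c) = B i k * c"
  unfolding L_def using sum_bump_mult[of k d c "\<lambda>j. B i j"] by (simp add: mult.commute)

text \<open>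
  Completing the square turns the exponential weight into a translation of the density.
\<close>

lemma exponential_moment:
  "(\<integral>\<^sup>+z. ennreal (exp (\<Sum>i<d. h i * L i z) * p z) \<partial>lebesgue_pow d) = ennreal (exp (quad d B h / 2))"
proof -
  have q: "quad d B (\<lambda>i. - h i) = quad d B h"
    using quad_smult[of d B "-1" h] by simp
  have "(\<integral>\<^sup>+z. ennreal (exp (\<Sum>i<d. h i * L i z) * p z) \<partial>lebesgue_pow d) =
     (\<integral>\<^sup>+z. ennreal (exp (quad d B h / 2)) * ennreal (p (translate d (\<lambda>i. - h i) z)) \<partial>lebesgue_pow d)"
    unfolding p_translate q
    by (intro nn_integral_cong)
       (simp add: ennreal_mult'[symmetric] sum_negf mult.assoc[symmetric] exp_add[symmetric])
  also have "\<dots> = ennreal (exp (quad d B h / 2)) *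
      (\<integral>\<^sup>+z. ennreal (p (translate d (\<lambda>i. - h i) z)) \<partial>lebesgue_pow d)"
    by (rule nn_integral_cmult) measurable
  also have "(\<integral>\<^sup>+z. ennreal (p (translate d (\<lambda>i. - h i) z)) \<partial>lebesgue_pow d) = 1"
    using nn_integral_translate[of "\<lambda>z. ennreal (p z)" d] by (simp add: nn_integral_p)
  finally show ?thesis by simp
qed

lemma S_L: "j < d \<Longrightarrow> (\<Sum>k<d. S j k * L k z) = z j"
proof -
  assume j: "j < d"
  have "(\<Sum>k<d. S j k * L k z) = (\<Sum>k<d. \<Sum>m<d. S j k * B k m * z m)"
    by (simp add: L_def sum_distrib_left mult.assoc)
  also have "\<dots> = (\<Sum>m<d. \<Sum>k<d. S j k * B k m * z m)" by (rule sum.swap)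
  also have "\<dots> = (\<Sum>m<d. bump j 1 m * z m)"
    using S_B[OF j] by (intro sum.cong refl) (auto simp: sum_distrib_right[symmetric] bump_def)
  also have "\<dots> = z j" using j by (simp add: sum_bump_mult)
  finally show ?thesis .
qed

lemma L_S: "j < d \<Longrightarrow> k < d \<Longrightarrow> L k (\<lambda>m. S j m) = (if j = k then 1 else 0)"
proof -
  assume jk: "j < d" "k < d"
  have "L k (\<lambda>m. S j m) = (\<Sum>m<d. S j m * B m k)"
    unfolding L_def using jk B_sym by (intro sum.cong refl) auto
  then show ?thesis using S_B[OF jk] by simp
qed

lemma L_smult: "L k (\<lambda>m. c * x m) = c * L k x"
  by (simp add: L_def sum_distrib_left mult_ac)

lemma quad_L: "quad d B x = (\<Sum>k<d. x k * L k x)"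
  unfolding quad_eq_sum L_def ..

text \<open>
  The joint Laplace transform of a coordinate and one functional: the shift to use is a multiple of
  the row \<open>j\<close> of \<open>S\<close>, which produces \<open>z j\<close>, plus a multiple of a unit vector, which produces \<open>L i\<close>.
\<close>

lemma exponential_moment_pair:
  assumes i: "i < d" and j: "j < d"
  shows "(\<integral>\<^sup>+z. ennreal (exp (\<alpha> * z j + \<beta> * L i z) * p z) \<partial>lebesgue_pow d) =
    ennreal (exp ((\<alpha>\<^sup>2 + 2 * \<alpha> * \<beta> * (if i = j then 1 else 0) + \<beta>\<^sup>2 * B i i) / 2))"
proof -
  define h where "h = (\<lambda>k. \<alpha> * S j k + bump i \<beta> k)"
  have "(\<Sum>k<d. h k * L k z) = \<alpha> * z j + \<beta> * L i z" for z
  proof -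
    have "(\<Sum>k<d. h k * L k z) = \<alpha> * (\<Sum>k<d. S j k * L k z) + (\<Sum>k<d. bump i \<beta> k * L k z)"
      by (simp add: h_def distrib_right sum.distrib sum_distrib_left mult.assoc)
    then show ?thesis using i j by (simp add: S_L sum_bump_mult)
  qed
  moreover have "quad d B h = \<alpha>\<^sup>2 + 2 * \<alpha> * \<beta> * (if i = j then 1 else 0) + \<beta>\<^sup>2 * B i i"
  proof -
    have "quad d B (\<lambda>k. \<alpha> * S j k) = \<alpha>\<^sup>2 * (\<Sum>k<d. S j k * (bump j 1 k))"
      unfolding quad_smult quad_L using j by (intro arg_cong2[of _ _ _ _ "(*)"] sum.cong refl) (auto simp: L_S bump_def)
    also have "\<dots> = \<alpha>\<^sup>2"
      using sum_bump_mult[of j d 1 "S j"] j S_diag by (simp add: mult.commute)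
    finally have 1: "quad d B (\<lambda>k. \<alpha> * S j k) = \<alpha>\<^sup>2" .
    show ?thesis
      unfolding h_def quad_add_L 1 using i j by (simp add: quad_bump sum_bump_mult L_smult L_S)
  qed
  ultimately show ?thesis using exponential_moment[of h] by simp
qed

definition W :: "nat set \<Rightarrow> (nat \<Rightarrow> real) \<Rightarrow> real" where
  "W J z = (\<Sum>j\<in>J. \<bar>L j z\<bar>)"

lemma W_measurable [measurable]: "W J \<in> borel_measurable (lebesgue_pow d)"
  unfolding W_def[abs_def] by measurable

lemma W_nonneg: "0 \<le> W J z"
  unfolding W_def by (simp add: sum_nonneg)

lemma L_le_W: "finite J \<Longrightarrow> j \<in> J \<Longrightarrow> \<bar>L j z\<bar> \<le> W J z"
  unfolding W_def by (rule member_le_sum) auto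

text \<open>
  The largest \<open>\<bar>L j z\<bar>\<close> bounds the sum up to the factor \<open>m\<close>. Hence a single functional appears in each
  exponent on the right, and the right side has explicit integrals.
\<close>

lemma exp_W_le:
  assumes J: "finite J" "J \<noteq> {}" "card J \<le> m" and c: "0 \<le> c"
  shows "exp (c * W J z) \<le> (\<Sum>j\<in>J. exp (m * c * L j z) + exp (- (m * c) * L j z))"
proof -
  have "Max ((\<lambda>j. \<bar>L j z\<bar>) ` J) \<in> (\<lambda>j. \<bar>L j z\<bar>) ` J" using J by (intro Max_in) auto
  then obtain j where j: "j \<in> J" "\<bar>L j z\<bar> = Max ((\<lambda>j. \<bar>L j z\<bar>) ` J)" by auto
  have "W J z \<le> (\<Sum>i\<in>J. \<bar>L j z\<bar>)"
    unfolding W_def using J j by (intro sum_mono) auto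
  also have "\<dots> \<le> m * \<bar>L j z\<bar>" using J by (simp add: mult_right_mono)
  finally have "c * W J z \<le> m * c * \<bar>L j z\<bar>" using c by (metis mult_left_mono mult.left_commute mult.assoc)
  then have "exp (c * W J z) \<le> exp (m * c * \<bar>L j z\<bar>)" by simp
  also have "\<dots> \<le> exp (m * c * L j z) + exp (- (m * c) * L j z)"
    by (cases "L j z \<ge> 0") (auto simp: add_increasing add_increasing2)
  also have "\<dots> \<le> (\<Sum>j\<in>J. exp (m * c * L j z) + exp (- (m * c) * L j z))"
    using J j by (intro member_le_sum[of j J "\<lambda>j. exp (m * c * L j z) + exp (- (m * c) * L j z)"]) (auto intro: add_nonneg_nonneg)
  finally show ?thesis .
qed

lemma nn_integral_exp_W_finite:
  assumes J: "J \<subseteq> {..<d}" "J \<noteq> {}" and c: "0 \<le> c"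
  shows "(\<integral>\<^sup>+z. ennreal (exp (c * W J z) * p z) \<partial>lebesgue_pow d) < \<infinity>"
proof -
  have fin: "finite J" using J(1) finite_subset by blast
  let ?m = "real (card J) * c"
  have "(\<integral>\<^sup>+z. ennreal (exp (c * W J z) * p z) \<partial>lebesgue_pow d) \<le>
     (\<integral>\<^sup>+z. (\<Sum>j\<in>J. ennreal (exp (?m * L j z) * p z) + ennreal (exp (- ?m * L j z) * p z)) \<partial>lebesgue_pow d)"
  proof (rule nn_integral_mono)
    fix z
    have "exp (c * W J z) * p z \<le> (\<Sum>j\<in>J. exp (?m * L j z) + exp (- ?m * L j z)) * p z"
      using exp_W_le[OF fin J(2) order_refl c, of z] by (intro mult_right_mono) auto
    also have "\<dots> = (\<Sum>j\<in>J. exp (?m * L j z) * p z + exp (- ?m * L j z) * p z)"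
      by (simp add: sum_distrib_right distrib_right)
    finally show "ennreal (exp (c * W J z) * p z) \<le>
       (\<Sum>j\<in>J. ennreal (exp (?m * L j z) * p z) + ennreal (exp (- ?m * L j z) * p z))"
      by (simp add: ennreal_plus[symmetric] sum_ennreal ennreal_leI del: ennreal_plus)
  qed
  also have "\<dots> = (\<Sum>j\<in>J. (\<integral>\<^sup>+z. ennreal (exp (?m * L j z) * p z) \<partial>lebesgue_pow d) +
      (\<integral>\<^sup>+z. ennreal (exp (- ?m * L j z) * p z) \<partial>lebesgue_pow d))"
    by (subst nn_integral_sum, measurable, intro sum.cong refl, subst nn_integral_add, auto)
  also have "\<dots> < \<infinity>"
  proof -
    have "(\<integral>\<^sup>+z. ennreal (exp (\<beta> * L j z) * p z) \<partial>lebesgue_pow d) < \<infinity>" if "j \<in> J" for j \<beta>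
    proof -
      have j: "j < d" using that J by auto
      show ?thesis
        using exponential_moment_pair[OF j j, of 0 \<beta>] by simp
    qed
    from this[of _ ?m] this[of _ "- ?m"] show ?thesis using fin by (simp add: less_top[symmetric])
  qed
  finally show ?thesis .
qed

lemma exp_W_p_integrable:
  assumes "J \<subseteq> {..<d}" "J \<noteq> {}" "0 \<le> c"
  shows "integrable (lebesgue_pow d) (\<lambda>z. exp (c * W J z) * p z)"
  using nn_integral_exp_W_finite[OF assms] by (intro integrableI_nonneg) auto

text \<open>
  On the event \<open>t \<le> \<bar>z j\<bar>\<close>, one of \<open>t z j - t\<^sup>2\<close> and \<open>- t z j - t\<^sup>2\<close> is nonnegative, so the
  indicator is at most the sum of the exponentials of both. Each summand then integrates to
  \<open>exp (- t\<^sup>2 / 2)\<close> times a cross term \<open>exp (t c)\<close> with \<open>c = m n\<close>, which costs half of the exponent: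
  \<open>t c \<le> t\<^sup>2 / 4 + c\<^sup>2\<close>. The functionals enter scaled by \<open>\<sigma>\<close>, which makes their variances at
  most 1; hence the bound depends on neither \<open>\<sigma>\<close> nor \<open>d\<close>.
\<close>

lemma tail_exp_W:
  assumes J: "J \<subseteq> {..<d}" "J \<noteq> {}" "card J \<le> m" and j: "j < d" and t: "0 \<le> t" and n: "0 \<le> (n :: real)"
  shows "(\<integral>\<^sup>+z. ennreal (indicator {z. t \<le> \<bar>z j\<bar>} z * (exp (n * \<sigma> * W J z) * p z)) \<partial>lebesgue_pow d) \<le>
    ennreal (4 * real m * exp (3 / 2 * (m * n)\<^sup>2) * exp (- t\<^sup>2 / 4))"
proof -
  have fin: "finite J" using J(1) finite_subset by blast
  define c where "c = real m * n"
  have c: "0 \<le> c" using n by (simp add: c_def)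
  define I where "I = {-1, 1 :: real}"
  have I: "finite I" "\<And>s. s \<in> I \<Longrightarrow> \<bar>s\<bar> = 1 \<and> s\<^sup>2 = 1" "card I = 2" by (auto simp: I_def)
  \<comment> \<open>The signs \<open>s\<close> and \<open>r\<close> remove the absolute values of \<open>z j\<close> and \<open>L i z\<close>; they account for the factor 4.\<close>
  define F where "F = (\<lambda>i s r z. exp (s * t * z j + r * c * \<sigma> * L i z) * p z)"
  have F: "(\<integral>\<^sup>+z. ennreal (F i s r z) \<partial>lebesgue_pow d) \<le> ennreal (exp (t\<^sup>2 / 2 + t * c + c\<^sup>2 / 2))"
    if "i \<in> J" "s \<in> I" "r \<in> I" for i s r
  proof -
    have i: "i < d" using that J by auto
    have "s * t * (r * c * \<sigma>) * (if i = j then 1 else 0) \<le> \<bar>s * t * (r * c * \<sigma>)\<bar>" by auto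
    also have "\<dots> = t * (c * \<sigma>)" using I(2)[OF that(2)] I(2)[OF that(3)] t c \<sigma>_pos by (simp add: abs_mult)
    also have "\<dots> \<le> t * c" using t c \<sigma>_le_1 \<sigma>_pos by (intro mult_left_mono) (auto simp: mult_left_le)
    finally have 1: "2 * (s * t) * (r * c * \<sigma>) * (if i = j then 1 else 0) \<le> 2 * (t * c)" by linarith
    have "(r * c * \<sigma>)\<^sup>2 * B i i \<le> (c * \<sigma>)\<^sup>2 * (1 / \<sigma>\<^sup>2)"
      using B_bound[OF i i] I(2)[OF that(3)]
      by (simp add: power_mult_distrib del: times_divide_eq_right) (intro mult_left_mono, auto)
    also have "\<dots> = c\<^sup>2" using \<sigma>_pos by (simp add: power_mult_distrib)
    finally have 2: "(r * c * \<sigma>)\<^sup>2 * B i i \<le> c\<^sup>2" .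
    have 3: "(s * t)\<^sup>2 = t\<^sup>2" using I(2)[OF that(2)] by (simp add: power_mult_distrib)
    show ?thesis
      unfolding F_def using 1 2 3
      by (subst exponential_moment_pair[OF i j, of "s * t" "r * c * \<sigma>"]) (auto intro!: ennreal_leI)
  qed
  have "(\<integral>\<^sup>+z. ennreal (indicator {z. t \<le> \<bar>z j\<bar>} z * (exp (n * \<sigma> * W J z) * p z)) \<partial>lebesgue_pow d) \<le>
    (\<integral>\<^sup>+z. (\<Sum>i\<in>J. \<Sum>s\<in>I. \<Sum>r\<in>I. ennreal (exp (- t\<^sup>2)) * ennreal (F i s r z)) \<partial>lebesgue_pow d)"
  proof (rule nn_integral_mono)
    fix z
    have a: "indicator {z. t \<le> \<bar>z j\<bar>} z \<le> (\<Sum>s\<in>I. exp (- t\<^sup>2) * exp (s * t * z j))"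
    proof (cases "t \<le> \<bar>z j\<bar>")
      case True
      then have "t\<^sup>2 \<le> t * \<bar>z j\<bar>" using t by (simp add: power2_eq_square mult_left_mono)
      then have "t\<^sup>2 \<le> t * z j \<or> t\<^sup>2 \<le> - (t * z j)" by (auto simp: abs_if split: if_splits)
      then have "1 \<le> exp (- t\<^sup>2 + t * z j) \<or> 1 \<le> exp (- t\<^sup>2 - t * z j)" by auto
      then have "1 \<le> exp (- t\<^sup>2 + t * z j) + exp (- t\<^sup>2 - t * z j)"
        by (smt (verit) exp_gt_zero)
      also have "\<dots> = (\<Sum>s\<in>I. exp (- t\<^sup>2) * exp (s * t * z j))"
        by (simp add: I_def exp_add[symmetric] add.commute)
      finally show ?thesis using True by simp
    next
      case False
      then show ?thesis by (simp add: sum_nonneg)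
    qed
    have b: "exp (n * \<sigma> * W J z) \<le> (\<Sum>i\<in>J. \<Sum>r\<in>I. exp (r * c * \<sigma> * L i z))"
      using exp_W_le[OF fin J(2,3), of "n * \<sigma>" z] n \<sigma>_pos by (simp add: I_def c_def mult_ac add.commute)
    have "indicator {z. t \<le> \<bar>z j\<bar>} z * (exp (n * \<sigma> * W J z) * p z) \<le>
       (\<Sum>s\<in>I. exp (- t\<^sup>2) * exp (s * t * z j)) * ((\<Sum>i\<in>J. \<Sum>r\<in>I. exp (r * c * \<sigma> * L i z)) * p z)"
      by (intro mult_mono a b mult_right_mono) (auto intro!: sum_nonneg mult_nonneg_nonneg)
    also have "\<dots> = (\<Sum>i\<in>J. \<Sum>s\<in>I. \<Sum>r\<in>I. exp (- t\<^sup>2) * F i s r z)"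
      by (simp add: I_def F_def sum_distrib_left sum_distrib_right exp_add sum.distrib algebra_simps)
    finally show "ennreal (indicator {z. t \<le> \<bar>z j\<bar>} z * (exp (n * \<sigma> * W J z) * p z)) \<le>
      (\<Sum>i\<in>J. \<Sum>s\<in>I. \<Sum>r\<in>I. ennreal (exp (- t\<^sup>2)) * ennreal (F i s r z))"
      by (simp add: ennreal_mult'[symmetric] sum_ennreal sum_nonneg F_def ennreal_leI)
  qed
  also have "\<dots> = (\<Sum>i\<in>J. \<Sum>s\<in>I. \<Sum>r\<in>I. ennreal (exp (- t\<^sup>2)) * (\<integral>\<^sup>+z. ennreal (F i s r z) \<partial>lebesgue_pow d))"
    using j unfolding F_def by (simp add: nn_integral_sum nn_integral_cmult)
  also have "\<dots> \<le> (\<Sum>i\<in>J. \<Sum>s\<in>I. \<Sum>r\<in>I. ennreal (exp (- t\<^sup>2)) * ennreal (exp (t\<^sup>2 / 2 + t * c + c\<^sup>2 / 2)))"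
    by (intro sum_mono mult_left_mono F) auto
  also have "\<dots> = (\<Sum>i\<in>J. \<Sum>s\<in>I. \<Sum>r\<in>I. ennreal (exp (- t\<^sup>2 / 2 + t * c + c\<^sup>2 / 2)))"
    by (simp add: ennreal_mult'[symmetric] exp_add[symmetric] algebra_simps)
  also have "\<dots> = ennreal (real (card J) * 4 * exp (- t\<^sup>2 / 2 + t * c + c\<^sup>2 / 2))"
    by (simp add: I(3) ennreal_mult' ennreal_of_nat_eq_real_of_nat mult.assoc[symmetric] sum_ennreal)
  also have "\<dots> \<le> ennreal (4 * real m * exp (3 / 2 * c\<^sup>2) * exp (- t\<^sup>2 / 4))"
  proof (rule ennreal_leI)
    have "- t\<^sup>2 / 2 + t * c + c\<^sup>2 / 2 \<le> 3 / 2 * c\<^sup>2 + - t\<^sup>2 / 4"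
      using zero_le_power2[of "t / 2 - c"] by (simp add: power2_eq_square field_simps)
    then have "exp (- t\<^sup>2 / 2 + t * c + c\<^sup>2 / 2) \<le> exp (3 / 2 * c\<^sup>2) * exp (- t\<^sup>2 / 4)"
      by (simp add: exp_add[symmetric])
    then have "real (card J) * exp (- t\<^sup>2 / 2 + t * c + c\<^sup>2 / 2) \<le> real m * (exp (3 / 2 * c\<^sup>2) * exp (- t\<^sup>2 / 4))"
      using J(3) by (intro mult_mono) auto
    then show "real (card J) * 4 * exp (- t\<^sup>2 / 2 + t * c + c\<^sup>2 / 2) \<le> 4 * real m * exp (3 / 2 * c\<^sup>2) * exp (- t\<^sup>2 / 4)"
      by simp
  qed
  finally show ?thesis unfolding c_def .
qed

end

section \<open>Differentiating Gaussian integrals\<close>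

text \<open>
  Differentiation under the integral sign: the mean value theorem bounds the difference quotients by
  the bound on the derivative, and dominated convergence applies.
\<close>

lemma has_real_derivative_integral:
  fixes F F' :: "real \<Rightarrow> 'a \<Rightarrow> real"
  assumes int: "\<And>s. \<bar>s\<bar> \<le> 1 \<Longrightarrow> integrable M (F s)"
    and meas: "F' 0 \<in> borel_measurable M"
    and deriv: "\<And>s z. z \<in> space M \<Longrightarrow> \<bar>s\<bar> \<le> 1 \<Longrightarrow> ((\<lambda>s. F s z) has_real_derivative F' s z) (at s)"
    and bound: "\<And>s z. z \<in> space M \<Longrightarrow> \<bar>s\<bar> \<le> 1 \<Longrightarrow> \<bar>F' s z\<bar> \<le> D z"
    and D: "integrable M D"
  shows "((\<lambda>s. \<integral>z. F s z \<partial>M) has_real_derivative (\<integral>z. F' 0 z \<partial>M)) (at 0)"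
proof -
  have "((\<lambda>h. ((\<integral>z. F h z \<partial>M) - (\<integral>z. F 0 z \<partial>M)) / h) \<longlongrightarrow> (\<integral>z. F' 0 z \<partial>M)) (at 0 within {-1..1})"
    unfolding tendsto_at_iff_sequentially
  proof (intro allI impI)
    fix X :: "nat \<Rightarrow> real"
    assume X: "\<forall>i. X i \<in> {-1..1} - {0}" and lim: "X \<longlonglongrightarrow> 0"
    have X1: "\<bar>X i\<bar> \<le> 1" "X i \<noteq> 0" for i using X[rule_format, of i] by (auto simp: abs_le_iff)
    have "(\<lambda>i. \<integral>z. (F (X i) z - F 0 z) / X i \<partial>M) \<longlonglongrightarrow> (\<integral>z. F' 0 z \<partial>M)"
    proof (rule integral_dominated_convergence[where w = D])
      show "F' 0 \<in> borel_measurable M" by (rule meas)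
      show "(\<lambda>z. (F (X i) z - F 0 z) / X i) \<in> borel_measurable M" for i
        using int[OF X1(1)] int[of 0] by (intro borel_measurable_divide borel_measurable_diff) auto
      show "integrable M D" by (rule D)
      show "AE z in M. (\<lambda>i. (F (X i) z - F 0 z) / X i) \<longlonglongrightarrow> F' 0 z"
      proof (rule AE_I2)
        fix z assume z: "z \<in> space M"
        have "((\<lambda>h. (F h z - F 0 z) / h) \<longlongrightarrow> F' 0 z) (at 0)"
          using deriv[OF z, of 0] by (simp add: has_field_derivative_iff)
        then show "(\<lambda>i. (F (X i) z - F 0 z) / X i) \<longlonglongrightarrow> F' 0 z"
          using X1(2) lim unfolding tendsto_at_iff_sequentially comp_def by auto
      qed
      show "AE z in M. norm ((F (X i) z - F 0 z) / X i) \<le> D z" for i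
      proof (rule AE_I2)
        fix z assume z: "z \<in> space M"
        have "norm (F (X i) z - F 0 z) \<le> D z * norm (X i - 0)"
        proof (rule field_differentiable_bound[of "{-1..1}"])
          show "convex {-1..1::real}" by simp
          fix s :: real assume "s \<in> {-1..1}"
          then have s: "\<bar>s\<bar> \<le> 1" by (auto simp: abs_le_iff)
          show "((\<lambda>s. F s z) has_field_derivative F' s z) (at s within {-1..1})"
            using deriv[OF z s] by (rule has_field_derivative_at_within)
          show "norm (F' s z) \<le> D z" using bound[OF z s] by simp
        qed (use X in auto)
        then show "norm ((F (X i) z - F 0 z) / X i) \<le> D z"
          using X1(2)[of i] by (simp add: divide_simps)
      qed
    qed
    moreover have "(\<integral>z. (F (X i) z - F 0 z) / X i \<partial>M) = ((\<integral>z. F (X i) z \<partial>M) - (\<integral>z. F 0 z \<partial>M)) / X i" for i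
      using int[OF X1(1)] int[of 0] by simp
    ultimately show "((\<lambda>h. ((\<integral>z. F h z \<partial>M) - (\<integral>z. F 0 z \<partial>M)) / h) \<circ> X) \<longlonglongrightarrow> (\<integral>z. F' 0 z \<partial>M)"
      by (simp only: comp_def)
  qed
  then show ?thesis
    by (simp add: has_field_derivative_iff at_within_interior[of 0 "{-1..1::real}"])
qed

context gaussian
begin

text \<open>
  The factors \<open>H\<close> with \<open>\<partial> p = H p\<close> for iterated derivatives \<open>\<partial>\<close> are multivariate Hermite polynomials.
  Only three features of them matter: they are built from the functionals \<open>L j\<close> with \<open>j \<in> J\<close>; a product of
  \<open>i\<close> functionals has a coefficient of size at most \<open>\<sigma>\<close> to the power \<open>i - n\<close>, with \<open>n\<close> the
  order of the derivative; and the normalized coefficients add up to at most \<open>K\<close>.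
\<close>

inductive scaled_poly :: "nat set \<Rightarrow> nat \<Rightarrow> real \<Rightarrow> ((nat \<Rightarrow> real) \<Rightarrow> real) \<Rightarrow> bool" for J where
  const: "\<bar>c\<bar> \<le> K / \<sigma> ^ n \<Longrightarrow> scaled_poly J n K (\<lambda>z. c)"
| linear: "j \<in> J \<Longrightarrow> scaled_poly J n K f \<Longrightarrow> scaled_poly J (Suc n) K (\<lambda>z. L j z * f z)"
| add: "scaled_poly J n K f \<Longrightarrow> scaled_poly J n K' g \<Longrightarrow> scaled_poly J n (K + K') (\<lambda>z. f z + g z)"

lemma scaled_poly_nonneg: "scaled_poly J n K f \<Longrightarrow> 0 \<le> K"
proof (induction rule: scaled_poly.induct)
  case (const c K n)
  then have "0 \<le> K / \<sigma> ^ n" by linarith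
  then show ?case using zero_less_power[OF \<sigma>_pos, of n] by (simp add: zero_le_divide_iff)
qed auto

lemma scaled_poly_scale:
  assumes "scaled_poly J n K f" "\<bar>c\<bar> \<le> 1 / \<sigma> ^ m"
  shows "scaled_poly J (n + m) K (\<lambda>z. c * f z)"
  using assms(1)
proof (induction rule: scaled_poly.induct)
  case (const b K n)
  have "\<bar>c * b\<bar> \<le> (1 / \<sigma> ^ m) * (K / \<sigma> ^ n)"
    unfolding abs_mult using const assms(2) \<sigma>_pos by (intro mult_mono) auto
  then show ?case by (intro scaled_poly.const) (simp add: power_add mult.commute)
next
  case (linear j n K f)
  from scaled_poly.linear[OF linear(1) linear(3)] show ?case by (simp add: mult.left_commute)
next
  case (add n K f K' g)
  from scaled_poly.add[OF add(3,4)] show ?case by (simp add: distrib_left)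
qed

lemma scaled_poly_measurable:
  assumes "J \<subseteq> {..<d}" "scaled_poly J n K f"
  shows "f \<in> borel_measurable (lebesgue_pow d)"
  using assms(2) by (induction rule: scaled_poly.induct) auto

text \<open>
  A functional is of size \<open>1 / \<sigma>\<close>: \<open>\<sigma> \<bar>L j z\<bar> \<le> exp (\<sigma> W J z)\<close>. So each of the \<open>n\<close> units of weight costs a
  factor \<open>1 / \<sigma>\<close> and at most one exponential.
\<close>

lemma scaled_poly_bound:
  assumes "finite J" "scaled_poly J n K f"
  shows "\<bar>f z\<bar> \<le> K / \<sigma> ^ n * exp (n * \<sigma> * W J z)"
  using assms(2)
proof (induction rule: scaled_poly.induct)
  case (const c K n)
  have "K / \<sigma> ^ n * 1 \<le> K / \<sigma> ^ n * exp (n * \<sigma> * W J z)"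
    using const \<sigma>_pos W_nonneg[of J z] by (intro mult_left_mono) auto
  then show ?case using const by simp
next
  case (linear j n K f)
  have "\<sigma> * \<bar>L j z\<bar> \<le> \<sigma> * W J z" using L_le_W[OF assms(1) linear(1)] \<sigma>_pos by simp
  also have "\<dots> \<le> exp (\<sigma> * W J z)" using exp_ge_add_one_self[of "\<sigma> * W J z"] by linarith
  finally have "\<bar>L j z\<bar> \<le> exp (\<sigma> * W J z) / \<sigma>" using \<sigma>_pos by (simp add: field_simps)
  then have "\<bar>L j z * f z\<bar> \<le> (exp (\<sigma> * W J z) / \<sigma>) * (K / \<sigma> ^ n * exp (n * \<sigma> * W J z))"
    unfolding abs_mult using linear(3) \<sigma>_pos by (intro mult_mono) auto
  also have "\<dots> = K / \<sigma> ^ Suc n * (exp (\<sigma> * W J z) * exp (n * \<sigma> * W J z))"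
    by simp
  also have "\<dots> = K / \<sigma> ^ Suc n * exp (real (Suc n) * \<sigma> * W J z)"
    by (simp add: exp_add[symmetric] algebra_simps)
  finally show ?case .
next
  case (add n K f K' g)
  then have "\<bar>f z + g z\<bar> \<le> K / \<sigma> ^ n * exp (n * \<sigma> * W J z) + K' / \<sigma> ^ n * exp (n * \<sigma> * W J z)"
    by linarith
  then show ?case by (simp add: add_divide_distrib distrib_right)
qed

text \<open>
  Differentiating replaces a functional \<open>L j\<close> by the constant \<open>B j k\<close>, which is of size \<open>1 / \<sigma>\<^sup>2\<close>: the
  weight goes up by one, and the product rule has at most \<open>n\<close> terms.
\<close>

lemma scaled_poly_deriv:
  assumes J: "J \<subseteq> {..<d}" and k: "k \<in> J" and "scaled_poly J n K f"
  shows "\<exists>f'. scaled_poly J (Suc n) (n * K) f' \<and>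
    (\<forall>z t. ((\<lambda>t. f (translate d (bump k t) z)) has_real_derivative f' (translate d (bump k t) z)) (at t))"
  using assms(3)
proof (induction rule: scaled_poly.induct)
  case (const c K n)
  have "0 \<le> K" using scaled_poly_nonneg[OF scaled_poly.const[OF const]] .
  then have "scaled_poly J (Suc n) (n * K) (\<lambda>z. 0)" using \<sigma>_pos by (intro scaled_poly.const) simp
  then show ?case by (intro exI[of _ "\<lambda>z. 0"]) auto
next
  case (linear j n K f)
  have kd: "k < d" "j < d" using J k linear(1) by auto
  obtain f' where f': "scaled_poly J (Suc n) (n * K) f'"
    and D: "\<And>z t. ((\<lambda>t. f (translate d (bump k t) z)) has_real_derivative f' (translate d (bump k t) z)) (at t)"
    using linear by blast
  have "scaled_poly J (n + 2) K (\<lambda>z. B j k * f z)"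
    by (rule scaled_poly_scale[OF linear(2)]) (use B_bound[OF kd(2,1)] in simp)
  from scaled_poly.add[OF this[simplified] scaled_poly.linear[OF linear(1) f']]
  have "scaled_poly J (Suc (Suc n)) (Suc n * K) (\<lambda>z. B j k * f z + L j z * f' z)"
    by (simp add: algebra_simps)
  moreover have "((\<lambda>t. L j (translate d (bump k t) z) * f (translate d (bump k t) z)) has_real_derivative
     B j k * f (translate d (bump k t) z) + L j (translate d (bump k t) z) * f' (translate d (bump k t) z)) (at t)" for z t
  proof -
    have "((\<lambda>t. L j z + B j k * t) has_real_derivative B j k) (at t)"
      by (auto intro!: derivative_eq_intros)
    from DERIV_mult[OF this D[of z t]] show ?thesis
      by (simp add: L_translate L_bump[OF kd(1)] algebra_simps)
  qed
  ultimately show ?case by blast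
next
  case (add n K f K' g)
  obtain f' where f': "scaled_poly J (Suc n) (n * K) f'"
    and Df: "\<And>z t. ((\<lambda>t. f (translate d (bump k t) z)) has_real_derivative f' (translate d (bump k t) z)) (at t)"
    using add by blast
  obtain g' where g': "scaled_poly J (Suc n) (n * K') g'"
    and Dg: "\<And>z t. ((\<lambda>t. g (translate d (bump k t) z)) has_real_derivative g' (translate d (bump k t) z)) (at t)"
    using add by blast
  have "scaled_poly J (Suc n) (n * (K + K')) (\<lambda>z. f' z + g' z)"
    using scaled_poly.add[OF f' g'] by (simp add: distrib_left)
  then show ?case using DERIV_add[OF Df Dg] by blast
qed

lemma p_translate_bump:
  "k < d \<Longrightarrow> p (translate d (bump k t) z) = exp (- t * L k z - t\<^sup>2 * B k k / 2) * p z"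
  by (simp add: p_translate sum_bump_mult quad_bump)

text \<open>
  \<open>\<partial> (f p) = (\<partial> f - L k f) p\<close>. The first term contributes \<open>n K\<close> to the coefficient sum and the second
  one \<open>K\<close>.
\<close>

lemma scaled_poly_density_deriv:
  assumes J: "J \<subseteq> {..<d}" and k: "k \<in> J" and f: "scaled_poly J n K f"
  shows "\<exists>g. scaled_poly J (Suc n) (real (Suc n) * K) g \<and>
    (\<forall>z t. ((\<lambda>t. f (translate d (bump k t) z) * p (translate d (bump k t) z)) has_real_derivative
       g (translate d (bump k t) z) * p (translate d (bump k t) z)) (at t))"
proof -
  have kd: "k < d" using J k by auto
  obtain f' where f': "scaled_poly J (Suc n) (n * K) f'"
    and D: "\<And>z t. ((\<lambda>t. f (translate d (bump k t) z)) has_real_derivative f' (translate d (bump k t) z)) (at t)"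
    using scaled_poly_deriv[OF assms] by blast
  have "scaled_poly J (Suc n + 0) K (\<lambda>z. - 1 * (L k z * f z))"
    by (rule scaled_poly_scale[OF scaled_poly.linear[OF k f]]) simp
  from scaled_poly.add[OF this[simplified] f']
  have "scaled_poly J (Suc n) (real (Suc n) * K) (\<lambda>z. - (L k z * f z) + f' z)" by (simp add: algebra_simps)
  moreover have "((\<lambda>t. f (translate d (bump k t) z) * p (translate d (bump k t) z)) has_real_derivative
       (- (L k (translate d (bump k t) z) * f (translate d (bump k t) z)) + f' (translate d (bump k t) z)) *
         p (translate d (bump k t) z)) (at t)" for z t
  proof -
    have "((\<lambda>t. p (translate d (bump k t) z)) has_real_derivative
        - L k (translate d (bump k t) z) * p (translate d (bump k t) z)) (at t)"
      unfolding p_translate_bump[OF kd] L_translate L_bump[OF kd]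
      by (auto intro!: derivative_eq_intros simp: algebra_simps)
    from DERIV_mult[OF D[of z t] this] show ?thesis by (simp add: algebra_simps)
  qed
  ultimately show ?thesis by blast
qed

text \<open>
  A bound that is uniform over short translations, as needed for differentiating under the integral.
  Translating by at most 1 in one coordinate changes each functional by a bounded amount and the
  density by a factor \<open>exp (W J z)\<close> at most, up to constants.
\<close>

lemma scaled_poly_density_translate_dominated:
  assumes J: "J \<subseteq> {..<d}" and k: "k \<in> J" and f: "scaled_poly J n K f"
  shows "\<exists>C c. 0 \<le> c \<and> (\<forall>z s. \<bar>s\<bar> \<le> 1 \<longrightarrow>
    \<bar>f (translate d (bump k s) z) * p (translate d (bump k s) z)\<bar> \<le> C * (exp (c * W J z) * p z))"
proof -
  have kd: "k < d" using J k by auto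
  have fin: "finite J" using J finite_subset by blast
  define b where "b = (\<Sum>j\<in>J. \<bar>B j k\<bar>)"
  define a where "a = real n * \<sigma>"
  have a: "0 \<le> a" using \<sigma>_pos by (simp add: a_def)
  have K: "0 \<le> K / \<sigma> ^ n" using scaled_poly_nonneg[OF f] \<sigma>_pos by simp
  define C where "C = K / \<sigma> ^ n * (exp (a * b) * exp (\<bar>B k k\<bar> / 2))"
  have "\<bar>f (translate d (bump k s) z) * p (translate d (bump k s) z)\<bar> \<le> C * (exp ((a + 1) * W J z) * p z)"
    if s: "\<bar>s\<bar> \<le> 1" for z s
  proof -
    have "W J (translate d (bump k s) z) \<le> (\<Sum>j\<in>J. \<bar>L j z\<bar> + \<bar>B j k\<bar>)"
      unfolding W_def
    proof (rule sum_mono)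
      fix j
      have "\<bar>B j k * s\<bar> \<le> \<bar>B j k\<bar>" using s by (simp add: abs_mult mult_left_le)
      then show "\<bar>L j (translate d (bump k s) z)\<bar> \<le> \<bar>L j z\<bar> + \<bar>B j k\<bar>"
        unfolding L_translate L_bump[OF kd] by linarith
    qed
    then have "W J (translate d (bump k s) z) \<le> W J z + b" by (simp add: W_def b_def sum.distrib)
    then have "a * W J (translate d (bump k s) z) \<le> a * (W J z + b)" using a by (rule mult_left_mono)
    then have "exp (a * W J (translate d (bump k s) z)) \<le> exp (a * b) * exp (a * W J z)"
      by (simp add: exp_add[symmetric] algebra_simps)
    then have "K / \<sigma> ^ n * exp (a * W J (translate d (bump k s) z)) \<le> K / \<sigma> ^ n * (exp (a * b) * exp (a * W J z))"
      using K by (rule mult_left_mono)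
    then have 1: "\<bar>f (translate d (bump k s) z)\<bar> \<le> K / \<sigma> ^ n * (exp (a * b) * exp (a * W J z))"
      using scaled_poly_bound[OF fin f, of "translate d (bump k s) z"] unfolding a_def by linarith
    have "\<bar>s * L k z\<bar> \<le> \<bar>L k z\<bar>" using s by (simp add: abs_mult mult_right_le_one_le mult_left_le_one_le)
    then have u: "- s * L k z \<le> W J z" using L_le_W[OF fin k, of z] by linarith
    have "s\<^sup>2 \<le> 1" using s by (simp add: abs_square_le_1)
    then have "s\<^sup>2 * \<bar>B k k\<bar> \<le> \<bar>B k k\<bar>" by (simp add: mult_left_le_one_le)
    moreover have "\<bar>s\<^sup>2 * B k k\<bar> = s\<^sup>2 * \<bar>B k k\<bar>" by (simp add: abs_mult)
    ultimately have "- (s\<^sup>2 * B k k / 2) \<le> \<bar>B k k\<bar> / 2" by linarith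
    with u have "exp (- s * L k z - s\<^sup>2 * B k k / 2) \<le> exp (\<bar>B k k\<bar> / 2) * exp (W J z)"
      by (simp add: exp_add[symmetric])
    then have 2: "\<bar>p (translate d (bump k s) z)\<bar> \<le> exp (\<bar>B k k\<bar> / 2) * exp (W J z) * p z"
      unfolding p_translate_bump[OF kd] by (simp add: abs_mult mult_right_mono)
    have "\<bar>f (translate d (bump k s) z) * p (translate d (bump k s) z)\<bar> \<le>
      (K / \<sigma> ^ n * (exp (a * b) * exp (a * W J z))) * (exp (\<bar>B k k\<bar> / 2) * exp (W J z) * p z)"
      unfolding abs_mult[of "f _"] by (intro mult_mono 1 2 mult_nonneg_nonneg K) auto
    also have "\<dots> = C * (exp ((a + 1) * W J z) * p z)"
      by (simp add: C_def distrib_right exp_add)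
    finally show ?thesis .
  qed
  then show ?thesis using a by (intro exI[of _ C] exI[of _ "a + 1"]) auto
qed

text \<open>
  With \<open>f = 1\<close> this is the smoothing of \<open>G\<close> by Gaussian noise of scale \<open>\<epsilon>\<close>; the factors \<open>f\<close> arise from
  its derivatives. The argument of \<open>G\<close> is restricted to indices below \<open>d\<close> so that it stays in the
  product space.
\<close>

definition smoothing :: "real \<Rightarrow> ((nat \<Rightarrow> real) \<Rightarrow> real) \<Rightarrow> ((nat \<Rightarrow> real) \<Rightarrow> real) \<Rightarrow> (nat \<Rightarrow> real) \<Rightarrow> real" where
  "smoothing \<epsilon> G f w = (\<integral>z. G (\<lambda>i\<in>{..<d}. w i + \<epsilon> * z i) * (f z * p z) \<partial>lebesgue_pow d)"

lemma affine_measurable [measurable]: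
  "(\<lambda>z. \<lambda>i\<in>{..<d}. w i + \<epsilon> * z i) \<in> measurable (lebesgue_pow d) (lebesgue_pow d)"
proof -
  have "(\<lambda>z. \<lambda>i\<in>{..<d}. w i + \<epsilon> * z i) \<in> measurable (lebesgue_pow d) (Pi\<^sub>M {..<d} (\<lambda>_. lborel))"
    by (rule measurable_restrict) simp
  then show ?thesis by (simp add: lebesgue_pow_def)
qed

lemma scaled_poly_density_translate_integrable:
  assumes J: "J \<subseteq> {..<d}" and k: "k \<in> J" and f: "scaled_poly J n K f"
    and G: "G \<in> borel_measurable (lebesgue_pow d)" "\<And>z. \<bar>G z\<bar> \<le> (1 :: real)" and s: "\<bar>s\<bar> \<le> 1"
  shows "integrable (lebesgue_pow d) (\<lambda>z. G z * (f (translate d (bump k s) z) * p (translate d (bump k s) z)))"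
proof -
  have [measurable]: "f \<in> borel_measurable (lebesgue_pow d)" by (rule scaled_poly_measurable[OF J f])
  note [measurable] = G(1)
  obtain C c where c: "0 \<le> c" and bd: "\<And>z. 
    \<bar>f (translate d (bump k s) z) * p (translate d (bump k s) z)\<bar> \<le> C * (exp (c * W J z) * p z)"
    using scaled_poly_density_translate_dominated[OF J k f] s by blast
  have "integrable (lebesgue_pow d) (\<lambda>z. C * (exp (c * W J z) * p z))"
    using exp_W_p_integrable[OF J _ c] k by auto
  then show ?thesis
  proof (rule Bochner_Integration.integrable_bound)
    show "AE z in lebesgue_pow d. norm (G z * (f (translate d (bump k s) z) * p (translate d (bump k s) z)))
        \<le> norm (C * (exp (c * W J z) * p z))"
    proof (rule AE_I2)
      fix z
      have "\<bar>G z\<bar> * \<bar>f (translate d (bump k s) z) * p (translate d (bump k s) z)\<bar> \<le> 1 * (C * (exp (c * W J z) * p z))"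
        by (intro mult_mono G(2) bd) auto
      also have "\<dots> \<le> \<bar>C * (exp (c * W J z) * p z)\<bar>" by simp
      finally show "norm (G z * (f (translate d (bump k s) z) * p (translate d (bump k s) z)))
        \<le> norm (C * (exp (c * W J z) * p z))" unfolding real_norm_def abs_mult[of "G z"] .
    qed
  qed measurable
qed

lemma smoothing_integrable:
  assumes J: "J \<subseteq> {..<d}" and ne: "J \<noteq> {}" and f: "scaled_poly J n K f"
    and G: "G \<in> borel_measurable (lebesgue_pow d)" "\<And>z. \<bar>G z\<bar> \<le> (1 :: real)"
  shows "integrable (lebesgue_pow d) (\<lambda>z. G (\<lambda>i\<in>{..<d}. w i + \<epsilon> * z i) * (f z * p z))"
proof -
  obtain k where k: "k \<in> J" using ne by auto
  have "integrable (lebesgue_pow d) (\<lambda>z. G (\<lambda>i\<in>{..<d}. w i + \<epsilon> * z i) *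
      (f (translate d (bump k 0) z) * p (translate d (bump k 0) z)))"
    using G by (intro scaled_poly_density_translate_integrable[OF J k f]) auto
  then show ?thesis by (rule Bochner_Integration.integrable_cong[THEN iffD1, rotated -1]) (auto simp: translate_0)
qed

text \<open>
  Translation invariance moves the displacement of \<open>w\<close> from \<open>G\<close>, which need not be smooth, to the smooth
  factor \<open>f p\<close>.
\<close>

lemma smoothing_bump:
  assumes k: "k < d" and "\<epsilon> \<noteq> 0" and [measurable]: "f \<in> borel_measurable (lebesgue_pow d)"
    "G \<in> borel_measurable (lebesgue_pow d)"
  shows "smoothing \<epsilon> G f (\<lambda>i. w i + bump k t i) =
    (\<integral>z. G (\<lambda>i\<in>{..<d}. w i + \<epsilon> * z i) *
       (f (translate d (bump k (- t / \<epsilon>)) z) * p (translate d (bump k (- t / \<epsilon>)) z)) \<partial>lebesgue_pow d)"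
proof -
  have "smoothing \<epsilon> G f (\<lambda>i. w i + bump k t i) =
    (\<integral>z. (\<lambda>z. G (\<lambda>i\<in>{..<d}. w i + bump k t i + \<epsilon> * z i) * (f z * p z)) (translate d (bump k (- t / \<epsilon>)) z) \<partial>lebesgue_pow d)"
    unfolding smoothing_def by (rule integral_translate[symmetric]) measurable
  also have "(\<lambda>i\<in>{..<d}. w i + bump k t i + \<epsilon> * translate d (bump k (- t / \<epsilon>)) z i) =
      (\<lambda>i\<in>{..<d}. w i + \<epsilon> * z i)" for z
    using \<open>\<epsilon> \<noteq> 0\<close> by (auto simp: restrict_def translate_apply bump_def fun_eq_iff algebra_simps)
  then have "(\<integral>z. (\<lambda>z. G (\<lambda>i\<in>{..<d}. w i + bump k t i + \<epsilon> * z i) * (f z * p z)) (translate d (bump k (- t / \<epsilon>)) z) \<partial>lebesgue_pow d) = 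
    (\<integral>z. G (\<lambda>i\<in>{..<d}. w i + \<epsilon> * z i) *
       (f (translate d (bump k (- t / \<epsilon>)) z) * p (translate d (bump k (- t / \<epsilon>)) z)) \<partial>lebesgue_pow d)"
    by simp
  finally show ?thesis .
qed

lemma smoothing_deriv:
  assumes J: "J \<subseteq> {..<d}" and k: "k \<in> J" and f: "scaled_poly J n K f" and g: "scaled_poly J m K' g"
    and D: "\<And>z t. ((\<lambda>t. f (translate d (bump k t) z) * p (translate d (bump k t) z)) has_real_derivative
       g (translate d (bump k t) z) * p (translate d (bump k t) z)) (at t)"
    and G: "G \<in> borel_measurable (lebesgue_pow d)" "\<And>z. \<bar>G z\<bar> \<le> (1 :: real)" and \<epsilon>: "\<epsilon> \<noteq> 0"
  shows "((\<lambda>t. smoothing \<epsilon> G f (\<lambda>i. w i + bump k t i)) has_real_derivative (- 1 / \<epsilon>) * smoothing \<epsilon> G g w) (at 0)"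
proof -
  have kd: "k < d" using J k by auto
  have [measurable]: "f \<in> borel_measurable (lebesgue_pow d)" "g \<in> borel_measurable (lebesgue_pow d)"
    using scaled_poly_measurable[OF J] f g by auto
  note [measurable] = G(1)
  define G' where "G' = (\<lambda>z. G (\<lambda>i\<in>{..<d}. w i + \<epsilon> * z i))"
  have G': "G' \<in> borel_measurable (lebesgue_pow d)" "\<And>z. \<bar>G' z\<bar> \<le> 1"
    using G by (auto simp: G'_def)
  note [measurable] = G'(1)
  obtain C c where c: "0 \<le> c" and bd: "\<And>z s. \<bar>s\<bar> \<le> 1 \<Longrightarrow>
    \<bar>g (translate d (bump k s) z) * p (translate d (bump k s) z)\<bar> \<le> C * (exp (c * W J z) * p z)"
    using scaled_poly_density_translate_dominated[OF J k g] by blast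
  let ?F = "\<lambda>s z. G' z * (f (translate d (bump k s) z) * p (translate d (bump k s) z))"
  let ?F' = "\<lambda>s z. G' z * (g (translate d (bump k s) z) * p (translate d (bump k s) z))"
  have "((\<lambda>s. \<integral>z. ?F s z \<partial>lebesgue_pow d) has_real_derivative (\<integral>z. ?F' 0 z \<partial>lebesgue_pow d)) (at 0)"
  proof (rule has_real_derivative_integral[where D = "\<lambda>z. C * (exp (c * W J z) * p z)"])
    show "integrable (lebesgue_pow d) (?F s)" if "\<bar>s\<bar> \<le> 1" for s
      by (rule scaled_poly_density_translate_integrable[OF J k f G' that])
    show "?F' 0 \<in> borel_measurable (lebesgue_pow d)" by measurable
    show "((\<lambda>s. ?F s z) has_real_derivative ?F' s z) (at s)" for s z
      by (rule DERIV_cmult[OF D])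
    show "\<bar>?F' s z\<bar> \<le> C * (exp (c * W J z) * p z)" if "\<bar>s\<bar> \<le> 1" for s z
      using mult_mono[OF G'(2) bd[OF that], of z z] unfolding abs_mult by simp
    show "integrable (lebesgue_pow d) (\<lambda>z. C * (exp (c * W J z) * p z))"
      using exp_W_p_integrable[OF J _ c] k by auto
  qed
  moreover have "(\<integral>z. ?F' 0 z \<partial>lebesgue_pow d) = smoothing \<epsilon> G g w"
    unfolding smoothing_def G'_def
    by (rule Bochner_Integration.integral_cong) (auto simp: translate_0)
  ultimately have "((\<lambda>s. \<integral>z. ?F s z \<partial>lebesgue_pow d) has_real_derivative smoothing \<epsilon> G g w) (at (- 0 / \<epsilon>))"
    by simp
  moreover have "((\<lambda>t. - t / \<epsilon>) has_real_derivative (- 1 / \<epsilon>)) (at 0)"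
    using \<epsilon> by (auto intro!: derivative_eq_intros)
  ultimately have "((\<lambda>t. \<integral>z. ?F (- t / \<epsilon>) z \<partial>lebesgue_pow d) has_real_derivative smoothing \<epsilon> G g w * (- 1 / \<epsilon>)) (at 0)"
    by (rule DERIV_chain2)
  moreover have "(\<integral>z. ?F (- t / \<epsilon>) z \<partial>lebesgue_pow d) = smoothing \<epsilon> G f (\<lambda>i. w i + bump k t i)" for t
    unfolding G'_def by (rule smoothing_bump[symmetric]) (use kd \<epsilon> in auto)
  ultimately show ?thesis by (simp add: mult.commute)
qed

lemma smoothing_tail_bound:
  assumes J: "J \<subseteq> {..<d}" "J \<noteq> {}" "card J \<le> n" and f: "scaled_poly J n K f"
    and j: "j < d" and t: "0 \<le> t"
    and G: "\<And>z. z \<in> space (lebesgue_pow d) \<Longrightarrow>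
      \<bar>G (\<lambda>i\<in>{..<d}. w i + \<epsilon> * z i)\<bar> \<le> indicator {z. t \<le> \<bar>z j\<bar>} z"
    and Gm: "G \<in> borel_measurable (lebesgue_pow d)" and G1: "\<And>z. \<bar>G z\<bar> \<le> 1"
  shows "\<bar>smoothing \<epsilon> G f w\<bar> \<le> K / \<sigma> ^ n * (4 * real n * exp (3 / 2 * (real n * real n)\<^sup>2) * exp (- t\<^sup>2 / 4))"
proof -
  have fin: "finite J" using J(1) finite_subset by blast
  have [measurable]: "f \<in> borel_measurable (lebesgue_pow d)" by (rule scaled_poly_measurable[OF J(1) f])
  note [measurable] = Gm
  have K: "0 \<le> K / \<sigma> ^ n" using scaled_poly_nonneg[OF f] \<sigma>_pos by simp
  let ?H = "\<lambda>z. indicator {z. t \<le> \<bar>z j\<bar>} z * (exp (n * \<sigma> * W J z) * p z)"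
  let ?R = "4 * real n * exp (3 / 2 * (real n * real n)\<^sup>2) * exp (- t\<^sup>2 / 4)"
  have "ennreal \<bar>smoothing \<epsilon> G f w\<bar> \<le>
     (\<integral>\<^sup>+z. ennreal (norm (G (\<lambda>i\<in>{..<d}. w i + \<epsilon> * z i) * (f z * p z))) \<partial>lebesgue_pow d)"
    using integral_norm_bound_ennreal[OF smoothing_integrable[OF J(1,2) f Gm G1, of w \<epsilon>]]
    by (simp add: smoothing_def)
  also have "\<dots> \<le> (\<integral>\<^sup>+z. ennreal (K / \<sigma> ^ n) * ennreal (?H z) \<partial>lebesgue_pow d)"
  proof (rule nn_integral_mono)
    fix z assume z: "z \<in> space (lebesgue_pow d)"
    have "\<bar>G (\<lambda>i\<in>{..<d}. w i + \<epsilon> * z i)\<bar> * (\<bar>f z\<bar> * p z) \<le>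
       indicator {z. t \<le> \<bar>z j\<bar>} z * ((K / \<sigma> ^ n * exp (n * \<sigma> * W J z)) * p z)"
      by (intro mult_mono G[OF z] mult_right_mono scaled_poly_bound[OF fin f]) auto
    then show "ennreal (norm (G (\<lambda>i\<in>{..<d}. w i + \<epsilon> * z i) * (f z * p z))) \<le> ennreal (K / \<sigma> ^ n) * ennreal (?H z)"
      using K by (simp add: abs_mult ennreal_mult'[symmetric] mult_ac ennreal_leI)
  qed
  also have "\<dots> = ennreal (K / \<sigma> ^ n) * (\<integral>\<^sup>+z. ennreal (?H z) \<partial>lebesgue_pow d)"
    using j by (intro nn_integral_cmult) measurable
  also have "\<dots> \<le> ennreal (K / \<sigma> ^ n) * ennreal ?R"
    by (rule mult_left_mono[OF tail_exp_W[OF J j t of_nat_0_le_iff]]) simp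
  also have "\<dots> = ennreal (K / \<sigma> ^ n * ?R)" by (rule ennreal_mult'[OF K, symmetric])
  finally have le: "ennreal \<bar>smoothing \<epsilon> G f w\<bar> \<le> ennreal (K / \<sigma> ^ n * ?R)" .
  have "0 \<le> K / \<sigma> ^ n * ?R" by (rule mult_nonneg_nonneg[OF K]) simp
  from ennreal_le_iff[OF this] le show ?thesis by blast
qed

end

section \<open>Iterated partial derivatives of a smoothed function\<close>

context gaussian
begin

lemma smoothing_cong:
  assumes "\<And>i. i < d \<Longrightarrow> w i = w' i"
  shows "smoothing \<epsilon> G f w = smoothing \<epsilon> G f w'"
proof -
  have "(\<lambda>i\<in>{..<d}. w i + \<epsilon> * z i) = (\<lambda>i\<in>{..<d}. w' i + \<epsilon> * z i)" for z
    using assms by (auto simp: restrict_def)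
  then show ?thesis by (simp add: smoothing_def)
qed

text \<open>
  The smoothing of a function that ignores the coordinate \<open>k\<close> is constant in that coordinate.
\<close>

lemma smoothing_deriv_zero:
  assumes J: "J \<subseteq> {..<d}" and k: "k \<in> J" and f: "scaled_poly J n K f" and g: "scaled_poly J m K' g"
    and D: "\<And>z t. ((\<lambda>t. f (translate d (bump k t) z) * p (translate d (bump k t) z)) has_real_derivative
       g (translate d (bump k t) z) * p (translate d (bump k t) z)) (at t)"
    and G: "G \<in> borel_measurable (lebesgue_pow d)" "\<And>z. \<bar>G z\<bar> \<le> (1 :: real)" and \<epsilon>: "\<epsilon> \<noteq> 0"
    and indep: "\<And>x t. G (x(k := t)) = G x"
  shows "smoothing \<epsilon> G g w = 0"
proof -
  have "G (\<lambda>i\<in>{..<d}. (w i + bump k t i) + \<epsilon> * z i) = G (\<lambda>i\<in>{..<d}. w i + \<epsilon> * z i)" for t z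
  proof -
    have "k < d" using J k by auto
    then have "(\<lambda>i\<in>{..<d}. (w i + bump k t i) + \<epsilon> * z i) =
        (\<lambda>i\<in>{..<d}. w i + \<epsilon> * z i)(k := w k + t + \<epsilon> * z k)"
      by (auto simp: bump_def restrict_def fun_eq_iff)
    then show ?thesis by (simp only: indep)
  qed
  then have "smoothing \<epsilon> G f (\<lambda>i. w i + bump k t i) = smoothing \<epsilon> G f w" for t
    by (simp add: smoothing_def)
  then have "((\<lambda>t. smoothing \<epsilon> G f w) has_real_derivative (- 1 / \<epsilon>) * smoothing \<epsilon> G g w) (at 0)"
    using smoothing_deriv[OF J k f g D G \<epsilon>, of w] by simp
  then have "(- 1 / \<epsilon>) * smoothing \<epsilon> G g w = 0"
    by (rule DERIV_unique) (rule DERIV_const)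
  then show ?thesis using \<epsilon> by simp
qed

text \<open>
  The factor \<open>H\<close> depends on the indices alone and serves all bounded functions \<open>G\<close> at once. This makes it
  possible to change \<open>G\<close> by a function that ignores the coordinate \<open>hd js\<close>, the one in which one
  differentiates last, without changing the derivative.
\<close>

lemma partial_derivs_smoothing:
  assumes J: "J \<subseteq> {..<d}" and \<epsilon>: "\<epsilon> \<noteq> 0" and "set js \<subseteq> J"
  shows "\<exists>H. scaled_poly J (length js) (fact (length js)) H \<and>
    (\<forall>G. G \<in> borel_measurable (lebesgue_pow d) \<longrightarrow> (\<forall>z. \<bar>G z\<bar> \<le> 1) \<longrightarrow>
      (\<forall>w\<in>carrier_vec d. partial_derivs d js (\<lambda>w. smoothing \<epsilon> G (\<lambda>_. 1) (($) w)) w =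
        (- 1 / \<epsilon>) ^ length js * smoothing \<epsilon> G H (($) w)) \<and>
      (js \<noteq> [] \<longrightarrow> (\<forall>x t. G (x(hd js := t)) = G x) \<longrightarrow> (\<forall>w. smoothing \<epsilon> G H w = 0)))"
  using assms(3)
proof (induction js)
  case Nil
  have "scaled_poly J 0 1 (\<lambda>_. 1)" by (rule scaled_poly.const) simp
  then show ?case by (intro exI[of _ "\<lambda>_. 1"]) (simp add: partial_derivs_def)
next
  case (Cons k js)
  let ?n = "length js"
  have k: "k \<in> J" "k < d" using Cons.prems J by auto
  obtain H where H: "scaled_poly J ?n (fact ?n) H"
    and IH: "\<And>G w. G \<in> borel_measurable (lebesgue_pow d) \<Longrightarrow> (\<forall>z. \<bar>G z\<bar> \<le> 1) \<Longrightarrow> w \<in> carrier_vec d \<Longrightarrow>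
       partial_derivs d js (\<lambda>w. smoothing \<epsilon> G (\<lambda>_. 1) (($) w)) w = (- 1 / \<epsilon>) ^ ?n * smoothing \<epsilon> G H (($) w)"
    using Cons by auto
  obtain g where g: "scaled_poly J (Suc ?n) (real (Suc ?n) * fact ?n) g"
    and D: "\<And>z t. ((\<lambda>t. H (translate d (bump k t) z) * p (translate d (bump k t) z)) has_real_derivative
       g (translate d (bump k t) z) * p (translate d (bump k t) z)) (at t)"
    using scaled_poly_density_deriv[OF J k(1) H] by blast
  have *: "partial_derivs d (k # js) (\<lambda>w. smoothing \<epsilon> G (\<lambda>_. 1) (($) w)) w =
        (- 1 / \<epsilon>) ^ Suc ?n * smoothing \<epsilon> G g (($) w)"
    if G: "G \<in> borel_measurable (lebesgue_pow d)" "\<And>z. \<bar>G z\<bar> \<le> 1" and w: "w \<in> carrier_vec d" for G w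
  proof -
    have "partial_derivs d js (\<lambda>w. smoothing \<epsilon> G (\<lambda>_. 1) (($) w)) (w + t \<cdot>\<^sub>v unit_vec d k) =
       (- 1 / \<epsilon>) ^ ?n * smoothing \<epsilon> G H (\<lambda>i. w $ i + bump k t i)" for t
    proof -
      have "partial_derivs d js (\<lambda>w. smoothing \<epsilon> G (\<lambda>_. 1) (($) w)) (w + t \<cdot>\<^sub>v unit_vec d k) =
        (- 1 / \<epsilon>) ^ ?n * smoothing \<epsilon> G H (($) (w + t \<cdot>\<^sub>v unit_vec d k))"
        by (rule IH) (use G w in auto)
      also have "smoothing \<epsilon> G H (($) (w + t \<cdot>\<^sub>v unit_vec d k)) = smoothing \<epsilon> G H (\<lambda>i. w $ i + bump k t i)"
        by (rule smoothing_cong) (use w k in \<open>auto simp: bump_def\<close>)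
      finally show ?thesis .
    qed
    moreover have "((\<lambda>t. (- 1 / \<epsilon>) ^ ?n * smoothing \<epsilon> G H (\<lambda>i. w $ i + bump k t i)) has_real_derivative
       (- 1 / \<epsilon>) ^ ?n * ((- 1 / \<epsilon>) * smoothing \<epsilon> G g (($) w))) (at 0)"
      by (rule DERIV_cmult) (rule smoothing_deriv[OF J k(1) H g D G \<epsilon>])
    ultimately have "deriv (\<lambda>t. partial_derivs d js (\<lambda>w. smoothing \<epsilon> G (\<lambda>_. 1) (($) w)) (w + t \<cdot>\<^sub>v unit_vec d k)) 0 =
        (- 1 / \<epsilon>) ^ ?n * ((- 1 / \<epsilon>) * smoothing \<epsilon> G g (($) w))"
      by (simp only: DERIV_imp_deriv)
    then show ?thesis by (simp add: partial_derivs_def partial_deriv_def)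
  qed
  show ?case
  proof (intro exI[of _ g] conjI allI impI ballI)
    show "scaled_poly J (length (k # js)) (fact (length (k # js))) g" using g by simp
    fix G :: "(nat \<Rightarrow> real) \<Rightarrow> real"
    assume G: "G \<in> borel_measurable (lebesgue_pow d)" "\<forall>z. \<bar>G z\<bar> \<le> 1"
    show "partial_derivs d (k # js) (\<lambda>w. smoothing \<epsilon> G (\<lambda>_. 1) (($) w)) w =
        (- 1 / \<epsilon>) ^ length (k # js) * smoothing \<epsilon> G g (($) w)" if "w \<in> carrier_vec d" for w
      using *[OF G(1) _ that] G(2) by simp
    show "smoothing \<epsilon> G g w = 0" if "\<forall>x t. G (x(hd (k # js) := t)) = G x" for w
      by (rule smoothing_deriv_zero[OF J k(1) H g D G(1) _ \<epsilon>]) (use G(2) that in \<open>simp_all only: list.sel\<close>)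
  qed
qed

end

section \<open>The truncated distance to a rectangle\<close>

text \<open>
  The amount by which the coordinate \<open>j\<close> violates its constraint; the ramp in \<open>rect_ramp\<close> is taken over
  an index set \<open>I\<close>, so that single constraints can be dropped.
\<close>

definition excess :: "(nat \<Rightarrow> ereal) \<Rightarrow> (nat \<Rightarrow> ereal) \<Rightarrow> (nat \<Rightarrow> real) \<Rightarrow> nat \<Rightarrow> ereal" where
  "excess a b x j = max (ereal (x j) - b j) (a j - ereal (x j))"

definition rect_ramp :: "real \<Rightarrow> (nat \<Rightarrow> ereal) \<Rightarrow> (nat \<Rightarrow> ereal) \<Rightarrow> nat set \<Rightarrow> (nat \<Rightarrow> real) \<Rightarrow> real" where
  "rect_ramp \<phi> a b I x = ramp \<phi> (Max (excess a b x ` I))"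

lemma m_fun_eq_rect_ramp: "m_fun d a b \<phi> w = rect_ramp \<phi> a b {..<d} (($) w)"
  by (simp add: m_fun_def rect_ramp_def excess_def[abs_def])

lemma ramp_bounds:
  assumes "\<phi> > 0" shows "0 \<le> ramp \<phi> t" "ramp \<phi> t \<le> 1"
  using assms by (cases t; auto simp: ramp_def field_simps)+

lemma ramp_measurable [measurable]: "ramp \<phi> \<in> borel_measurable borel"
  unfolding ramp_def[abs_def] by measurable

lemma rect_ramp_measurable:
  assumes "I \<subseteq> {..<d}"
  shows "rect_ramp \<phi> a b I \<in> borel_measurable (lebesgue_pow d)"
proof -
  have "finite I" using assms finite_subset by blast
  moreover have "(\<lambda>x. excess a b x j) \<in> borel_measurable (lebesgue_pow d)" if "j \<in> I" for j
  proof -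
    have [simp]: "j < d" using that assms by auto
    show ?thesis unfolding excess_def by measurable
  qed
  ultimately have "(\<lambda>x. Max (excess a b x ` I)) \<in> borel_measurable (lebesgue_pow d)"
    by (rule borel_measurable_Max)
  then show ?thesis unfolding rect_ramp_def[abs_def] by measurable
qed

lemma rect_ramp_indep: "j \<notin> I \<Longrightarrow> rect_ramp \<phi> a b I (x(j := t)) = rect_ramp \<phi> a b I x"
proof -
  assume "j \<notin> I"
  then have "excess a b (x(j := t)) ` I = excess a b x ` I"
    by (intro image_cong refl) (auto simp: excess_def)
  then show ?thesis by (simp add: rect_ramp_def)
qed

text \<open>
  A satisfied constraint does not influence the ramp, which is constant on the nonpositive numbers.
  The index set must keep another element because the maximum of the empty set is unspecified.
\<close>

lemma rect_ramp_remove: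
  assumes "finite I" "j \<in> I" "I - {j} \<noteq> {}" "excess a b x j \<le> 0"
  shows "rect_ramp \<phi> a b I x = rect_ramp \<phi> a b (I - {j}) x"
proof -
  let ?M = "Max (excess a b x ` (I - {j}))"
  have "Max (excess a b x ` I) = Max (insert (excess a b x j) (excess a b x ` (I - {j})))"
    using assms(2) by (metis image_insert insert_Diff)
  also have "\<dots> = max (excess a b x j) ?M" using assms by (intro Max_insert) auto
  finally have eq: "Max (excess a b x ` I) = max (excess a b x j) ?M" .
  show ?thesis
  proof (cases "?M \<le> 0")
    case True
    then show ?thesis using assms(4) unfolding rect_ramp_def eq by (simp add: ramp_def)
  next
    case False
    then have "excess a b x j \<le> ?M" using assms(4) by (meson linear order_trans)
    then have "max (excess a b x j) ?M = ?M" by (rule max_absorb2)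
    then show ?thesis unfolding rect_ramp_def eq by simp
  qed
qed

lemma rect_ramp_eq_0:
  assumes "finite I" "j \<in> I" "ereal (1 / \<phi>) \<le> excess a b x j" "\<phi> > 0"
  shows "rect_ramp \<phi> a b I x = 0"
proof -
  have "excess a b x j \<le> Max (excess a b x ` I)" using assms by simp
  then have ge: "ereal (1 / \<phi>) \<le> Max (excess a b x ` I)" using assms(3) by (rule order_trans[rotated])
  have "0 < ereal (1 / \<phi>)" using assms(4) by simp
  then have "0 < Max (excess a b x ` I)" using ge by (rule less_le_trans)
  with ge show ?thesis unfolding rect_ramp_def ramp_def by (simp add: not_le[symmetric])
qed

text \<open>
  A coordinate at depth \<open>s\<close> inside its interval remains inside after a displacement by at most \<open>s\<close>.
\<close>

lemma excess_inside:
  assumes "a j - ereal (- s) < ereal w" "ereal w \<le> b j + ereal (- s)" "\<bar>x j - w\<bar> \<le> s"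
  shows "excess a b x j \<le> 0"
  using assms unfolding excess_def by (cases "a j"; cases "b j"; auto)

text \<open>
  A coordinate at distance \<open>s + q\<close> outside its interval retains an excess of \<open>q\<close>, infinite endpoints
  included.
\<close>

lemma excess_outside:
  assumes "\<not> (a j - ereal (s + q) < ereal w \<and> ereal w \<le> b j + ereal (s + q))" "\<bar>x j - w\<bar> \<le> s"
  shows "ereal q \<le> excess a b x j"
  using assms unfolding excess_def le_max_iff_disj by (cases "a j"; cases "b j"; auto)

section \<open>Away from the boundary of the rectangle\<close>

text \<open>
  The factorial is the coefficient sum of the derivative factor of order \<open>n\<close>; the rest is the tail
  estimate for at most \<open>n\<close> functionals and weight \<open>n\<close>.
\<close>

definition tail_const :: "nat \<Rightarrow> real" where
  "tail_const n = fact n * (4 * real n * exp (3 / 2 * (real n * real n)\<^sup>2))"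

context gaussian
begin

text \<open>
  Since \<open>\<bar>y j\<bar> \<le> \<epsilon> \<sigma> \<eta> \<le> \<epsilon> \<eta>\<close>, the displacement \<open>y + \<epsilon> z\<close> of \<open>w\<close> stays within \<open>2 \<epsilon> \<kappa>\<close> in a coordinate \<open>j\<close>
  with \<open>\<bar>z j\<bar> < 2 \<kappa> - \<eta>\<close>. There a constraint that holds with margin \<open>2 \<epsilon> \<kappa>\<close> still holds, and one that
  fails by \<open>2 \<epsilon> \<kappa> + 1 / \<phi>\<close> still fails by \<open>1 / \<phi>\<close>, where the ramp is zero.
\<close>

lemma partial_derivs_rect_ramp_bound:
  assumes \<phi>: "\<phi> > 0" and \<epsilon>: "\<epsilon> > 0" and d: "d \<ge> 2" and js: "js \<noteq> []" "set js \<subseteq> {..<d}"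
    and \<kappa>: "\<eta> > 0" "\<kappa> > \<eta>" and w: "w \<in> carrier_vec d"
    and away: "w \<notin> enlarged_rect d a b (2 * \<epsilon> * \<kappa> + 1 / \<phi>) - enlarged_rect d a b (- (2 * \<epsilon> * \<kappa>))"
    and y: "y \<in> cube d (\<epsilon> * \<sigma> * \<eta>)"
  shows "\<bar>partial_derivs d js (\<lambda>w. smoothing \<epsilon> (rect_ramp \<phi> a b {..<d}) (\<lambda>_. 1) (($) w)) (w + y)\<bar> \<le>
    tail_const (length js) / (\<epsilon> * \<sigma>) ^ length js * exp (- (\<kappa> - \<eta>)\<^sup>2 / 4)"
proof -
  define n where "n = length js"
  define t where "t = 2 * \<kappa> - \<eta>"
  have t: "0 \<le> t" using \<kappa> by (simp add: t_def)
  let ?M = "rect_ramp \<phi> a b {..<d}"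
  have M: "?M \<in> borel_measurable (lebesgue_pow d)" "\<And>x. \<bar>?M x\<bar> \<le> 1"
    using rect_ramp_measurable[of "{..<d}" d] ramp_bounds[OF \<phi>] by (auto simp: rect_ramp_def)
  have J: "set js \<subseteq> {..<d}" "set js \<noteq> {}" "card (set js) \<le> n"
    using js by (auto simp: n_def card_length)
  have \<epsilon>0: "\<epsilon> \<noteq> 0" using \<epsilon> by simp
  obtain H where H: "scaled_poly (set js) n (fact n) H"
    and deriv: "\<And>G w. G \<in> borel_measurable (lebesgue_pow d) \<Longrightarrow> \<forall>z. \<bar>G z\<bar> \<le> 1 \<Longrightarrow> w \<in> carrier_vec d \<Longrightarrow>
       partial_derivs d js (\<lambda>w. smoothing \<epsilon> G (\<lambda>_. 1) (($) w)) w = (- 1 / \<epsilon>) ^ n * smoothing \<epsilon> G H (($) w)"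
    and zero: "\<And>G w. G \<in> borel_measurable (lebesgue_pow d) \<Longrightarrow> \<forall>z. \<bar>G z\<bar> \<le> 1 \<Longrightarrow>
       \<forall>x t. G (x(hd js := t)) = G x \<Longrightarrow> smoothing \<epsilon> G H w = 0"
    using partial_derivs_smoothing[OF J(1) \<epsilon>0 order_refl] js(1) unfolding n_def by blast
  have yc: "y \<in> carrier_vec d" using y by (simp add: cube_def)
  let ?w = "($) (w + y)"
  have near: "\<bar>(\<lambda>i\<in>{..<d}. (w + y) $ i + \<epsilon> * z i) j - w $ j\<bar> \<le> 2 * \<epsilon> * \<kappa>" if j: "j < d" and z: "\<bar>z j\<bar> < t" for z j
  proof -
    have "\<bar>y $ j\<bar> \<le> linf_norm y" using yc j by (auto simp: linf_norm_def intro!: Max_ge)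
    also have "\<dots> \<le> \<epsilon> * \<sigma> * \<eta>" using y by (simp add: cube_def)
    also have "\<dots> \<le> \<epsilon> * 1 * \<eta>" using \<epsilon> \<kappa> \<sigma>_le_1 by (intro mult_right_mono mult_left_mono) auto
    finally have 1: "\<bar>y $ j\<bar> \<le> \<epsilon> * \<eta>" by simp
    have "\<bar>\<epsilon> * z j\<bar> \<le> \<epsilon> * t" using \<epsilon> z by (simp add: abs_mult)
    then have "\<bar>y $ j + \<epsilon> * z j\<bar> \<le> \<epsilon> * \<eta> + \<epsilon> * t" using 1 by linarith
    also have "\<dots> = 2 * \<epsilon> * \<kappa>" by (simp add: t_def algebra_simps)
    finally show ?thesis using j w yc by simp
  qed
  have "\<bar>smoothing \<epsilon> ?M H ?w\<bar> \<le> fact n / \<sigma> ^ n * (4 * real n * exp (3 / 2 * (real n * real n)\<^sup>2) * exp (- t\<^sup>2 / 4))"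
  proof (cases "w \<in> enlarged_rect d a b (- (2 * \<epsilon> * \<kappa>))")
    case True
    define j where "j = hd js"
    have j: "j < d" using js(2) hd_in_set[OF js(1)] by (auto simp: j_def)
    let ?N = "rect_ramp \<phi> a b ({..<d} - {j})"
    have N: "?N \<in> borel_measurable (lebesgue_pow d)" "\<And>x. \<bar>?N x\<bar> \<le> 1"
      using rect_ramp_measurable[of "{..<d} - {j}" d] ramp_bounds[OF \<phi>] by (auto simp: rect_ramp_def)
    have other: "{..<d} - {j} \<noteq> {}"
    proof -
      have "(if j = 0 then 1 else 0) \<in> {..<d} - {j}" using d by auto
      then show ?thesis by blast
    qed
    \<comment> \<open>Subtracting the ramp without the constraint \<open>j\<close> does not change the derivative.\<close>
    let ?G = "\<lambda>x. ?M x - ?N x"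
    have G1: "\<bar>?G x\<bar> \<le> 1" for x
      using ramp_bounds[OF \<phi>] unfolding rect_ramp_def by (smt (verit))
    have "smoothing \<epsilon> ?G H ?w = smoothing \<epsilon> ?M H ?w - smoothing \<epsilon> ?N H ?w"
      unfolding smoothing_def left_diff_distrib
      by (rule Bochner_Integration.integral_diff) (rule smoothing_integrable[OF J(1,2) H M] smoothing_integrable[OF J(1,2) H N])+
    also have "smoothing \<epsilon> ?N H ?w = 0"
      using N by (intro zero) (auto simp: j_def rect_ramp_indep)
    finally have eq: "smoothing \<epsilon> ?M H ?w = smoothing \<epsilon> ?G H ?w" by simp
    show ?thesis
      unfolding eq
    proof (rule smoothing_tail_bound[OF J H j t])
      fix z
      let ?x = "\<lambda>i\<in>{..<d}. (w + y) $ i + \<epsilon> * z i"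
      show "\<bar>?G ?x\<bar> \<le> indicator {z. t \<le> \<bar>z j\<bar>} z"
      proof (cases "t \<le> \<bar>z j\<bar>")
        case True
        then show ?thesis using G1 by simp
      next
        case False
        have "excess a b ?x j \<le> 0"
        proof (rule excess_inside[of a j "2 * \<epsilon> * \<kappa>" "w $ j" b ?x])
          show "\<bar>?x j - w $ j\<bar> \<le> 2 * \<epsilon> * \<kappa>" using False by (intro near[OF j]) simp
        qed (use True j in \<open>auto simp: enlarged_rect_def\<close>)
        then have "?M ?x = ?N ?x" using other j by (intro rect_ramp_remove) auto
        then show ?thesis by simp
      qed
    qed (use M N G1 in \<open>auto intro!: borel_measurable_diff\<close>)
  next
    case False
    then have "w \<notin> enlarged_rect d a b (2 * \<epsilon> * \<kappa> + 1 / \<phi>)" using away by auto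
    then obtain k where k: "k < d" and out: "\<not> (a k - ereal (2 * \<epsilon> * \<kappa> + 1 / \<phi>) < ereal (w $ k) \<and>
        ereal (w $ k) \<le> b k + ereal (2 * \<epsilon> * \<kappa> + 1 / \<phi>))"
      using w unfolding enlarged_rect_def by auto
    show ?thesis
    proof (rule smoothing_tail_bound[OF J H k t])
      fix z
      let ?x = "\<lambda>i\<in>{..<d}. (w + y) $ i + \<epsilon> * z i"
      show "\<bar>?M ?x\<bar> \<le> indicator {z. t \<le> \<bar>z k\<bar>} z"
      proof (cases "t \<le> \<bar>z k\<bar>")
        case True
        then show ?thesis using M(2)[of ?x] by simp
      next
        case False
        have "ereal (1 / \<phi>) \<le> excess a b ?x k"
        proof (rule excess_outside[of a k "2 * \<epsilon> * \<kappa>" "1 / \<phi>" "w $ k" b ?x, OF out])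
          show "\<bar>?x k - w $ k\<bar> \<le> 2 * \<epsilon> * \<kappa>" using False by (intro near[OF k]) simp
        qed
        then have "?M ?x = 0" using k \<phi> by (intro rect_ramp_eq_0) auto
        then show ?thesis by simp
      qed
    qed (use M in auto)
  qed
  also have "\<dots> = tail_const n / \<sigma> ^ n * exp (- t\<^sup>2 / 4)"
    by (simp add: tail_const_def)
  also have "\<dots> \<le> tail_const n / \<sigma> ^ n * exp (- (\<kappa> - \<eta>)\<^sup>2 / 4)"
  proof (rule mult_left_mono)
    have "(\<kappa> - \<eta>)\<^sup>2 \<le> t\<^sup>2" using \<kappa> by (intro power_mono) (auto simp: t_def)
    then show "exp (- t\<^sup>2 / 4) \<le> exp (- (\<kappa> - \<eta>)\<^sup>2 / 4)" by simp
    show "0 \<le> tail_const n / \<sigma> ^ n" using \<sigma>_pos by (simp add: tail_const_def)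
  qed
  finally have bd: "\<bar>smoothing \<epsilon> ?M H ?w\<bar> \<le> tail_const n / \<sigma> ^ n * exp (- (\<kappa> - \<eta>)\<^sup>2 / 4)" .
  have "\<bar>partial_derivs d js (\<lambda>w. smoothing \<epsilon> ?M (\<lambda>_. 1) (($) w)) (w + y)\<bar> = (1 / \<epsilon>) ^ n * \<bar>smoothing \<epsilon> ?M H ?w\<bar>"
    using deriv[OF M(1), of "w + y"] M(2) w yc \<epsilon> by (simp add: abs_mult power_abs)
  also have "\<dots> \<le> (1 / \<epsilon>) ^ n * (tail_const n / \<sigma> ^ n * exp (- (\<kappa> - \<eta>)\<^sup>2 / 4))"
    using bd \<epsilon> by (intro mult_left_mono) auto
  also have "\<dots> = tail_const n / (\<epsilon> * \<sigma>) ^ n * exp (- (\<kappa> - \<eta>)\<^sup>2 / 4)"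
    by (simp add: power_mult_distrib power_one_over field_simps)
  finally show ?thesis unfolding n_def .
qed

end

lemma gaussian_precision:
  assumes S: "sym_pos_def d S" and diag: "\<forall>j<d. S $$ (j, j) = 1" and d: "d > 0"
  shows "gaussian d (precision S) (\<lambda>i j. S $$ (i, j)) (sqrt ((2 * pi) ^ d * Determinant.det S)) (sigma_star S)"
proof
  show "precision S i j = precision S j i" if "i < d" "j < d" for i j
    by (rule precision_sym[OF S that])
  show "(\<Sum>k<d. S $$ (i, k) * precision S k j) = (if i = j then 1 else 0)" if "i < d" "j < d" for i j
    by (rule precision_inverse[OF S that])
  show "S $$ (i, i) = 1" if "i < d" for i using diag that by simp
  show "0 < sqrt ((2 * pi) ^ d * Determinant.det S)" using precision_gaussian_integral(1)[OF S] by simp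
  show "(\<integral>\<^sup>+z. ennreal (exp (- quad d (precision S) z / 2)) \<partial>lebesgue_pow d) =
      ennreal (sqrt ((2 * pi) ^ d * Determinant.det S))" by (rule precision_gaussian_integral(2)[OF S])
  show "0 < sigma_star S" by (rule sigma_star_rayleigh(1)[OF S d])
  show "sigma_star S \<le> 1" by (rule sigma_star_le_1[OF S d]) (use diag d in simp)
  show "\<bar>precision S i j\<bar> \<le> 1 / (sigma_star S)\<^sup>2" if "i < d" "j < d" for i j
    by (rule precision_bound[OF S that])
qed

lemma rho_eq_smoothing:
  assumes S: "sym_pos_def d S" and diag: "\<forall>j<d. S $$ (j, j) = 1" and d: "d > 0"
  shows "rho d a b \<phi> \<epsilon> S = (\<lambda>w. gaussian.smoothing d (precision S) (sqrt ((2 * pi) ^ d * Determinant.det S)) \<epsilon>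
    (rect_ramp \<phi> a b {..<d}) (\<lambda>_. 1) (($) w))"
proof
  fix w
  define N where "N = sqrt ((2 * pi) ^ d * Determinant.det S)"
  interpret gaussian d "precision S" "\<lambda>i j. S $$ (i, j)" N "sigma_star S"
    unfolding N_def by (rule gaussian_precision[OF assms])
  have "vec d z \<bullet> (the (mat_inverse S) *\<^sub>v vec d z) = quad d (precision S) z" for z
    using quad_eq_scalar_prod[OF sym_pos_def_inverse(1)[OF S], of z]
    by (simp add: precision_def[abs_def])
  then have "normal_density_mat d S (vec d z) = p z" for z
    by (simp only: normal_density_mat_def p_def N_def[symmetric])
  then have law: "normal_law d S = density (lebesgue_pow d) (\<lambda>z. ennreal (p z))"
    by (simp add: normal_law_def lebesgue_pow_def)
  have m: "m_fun d a b \<phi> (w + \<epsilon> \<cdot>\<^sub>v vec d z) = rect_ramp \<phi> a b {..<d} (\<lambda>i\<in>{..<d}. w $ i + \<epsilon> * z i)" for z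
  proof -
    have "excess a b (($) (w + \<epsilon> \<cdot>\<^sub>v vec d z)) ` {..<d} = excess a b (\<lambda>i\<in>{..<d}. w $ i + \<epsilon> * z i) ` {..<d}"
      by (intro image_cong refl) (auto simp: excess_def)
    then show ?thesis by (simp add: m_fun_eq_rect_ramp rect_ramp_def)
  qed
  have [measurable]: "rect_ramp \<phi> a b {..<d} \<in> borel_measurable (lebesgue_pow d)"
    by (rule rect_ramp_measurable) simp
  have "rho d a b \<phi> \<epsilon> S w = smoothing \<epsilon> (rect_ramp \<phi> a b {..<d}) (\<lambda>_. 1) (($) w)"
    unfolding rho_def law m smoothing_def
    by (subst integral_density) (auto simp: mult.commute)
  then show "rho d a b \<phi> \<epsilon> S w = gaussian.smoothing d (precision S) (sqrt ((2 * pi) ^ d * Determinant.det S)) \<epsilon>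
    (rect_ramp \<phi> a b {..<d}) (\<lambda>_. 1) (($) w)"
    by (simp only: N_def)
qed

theorem lemma6p3:
  fixes v :: nat
  assumes "v \<ge> 1"
  shows "\<exists>C::real. C > 0 \<and>
    (\<forall>(d::nat) (\<phi>::real) (\<epsilon>::real) (S::real mat) (a::nat \<Rightarrow> ereal) (b::nat \<Rightarrow> ereal)
        (\<kappa>::real) (\<eta>::real).
      d \<ge> 3 \<longrightarrow> \<phi> > 0 \<longrightarrow> 0 < \<epsilon> \<longrightarrow> \<epsilon> \<le> 1 \<longrightarrow>
      sym_pos_def d S \<longrightarrow> (\<forall>j<d. S $$ (j, j) = 1) \<longrightarrow>
      (\<forall>j<d. a j \<le> b j) \<longrightarrow>
      \<kappa> > 0 \<longrightarrow> \<eta> > 0 \<longrightarrow> \<kappa> > \<eta> \<longrightarrow>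
      (SUP w \<in> carrier_vec d -
          (enlarged_rect d a b (2 * \<epsilon> * \<kappa> + 1 / \<phi>) - enlarged_rect d a b (- (2 * \<epsilon> * \<kappa>))).
         \<Sum>js \<in> {js. length js = v \<and> set js \<subseteq> {..<d}}.
           SUP y \<in> cube d (\<epsilon> * sigma_star S * \<eta>).
             ennreal \<bar>partial_derivs d js (rho d a b \<phi> \<epsilon> S) (w + y)\<bar>)
      \<le> ennreal (C * (real d ^ v / (\<epsilon> * sigma_star S) ^ v) * exp (- ((\<kappa> - \<eta>)\<^sup>2) / 4)))"
proof (intro exI[of _ "tail_const v"] conjI allI impI)
  show "0 < tail_const v" using assms by (simp add: tail_const_def)
  fix d :: nat and \<phi> \<epsilon> :: real and S :: "real mat" and a b :: "nat \<Rightarrow> ereal" and \<kappa> \<eta> :: real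
  assume d: "d \<ge> 3" and \<phi>: "\<phi> > 0" and \<epsilon>: "0 < \<epsilon>" and S: "sym_pos_def d S"
    and diag: "\<forall>j<d. S $$ (j, j) = 1" and \<kappa>: "\<eta> > 0" "\<kappa> > \<eta>"
  have d0: "d > 0" using d by simp
  interpret gaussian d "precision S" "\<lambda>i j. S $$ (i, j)" "sqrt ((2 * pi) ^ d * Determinant.det S)" "sigma_star S"
    by (rule gaussian_precision[OF S diag d0])
  let ?R = "tail_const v / (\<epsilon> * sigma_star S) ^ v * exp (- (\<kappa> - \<eta>)\<^sup>2 / 4)"
  let ?A = "{js. length js = v \<and> set js \<subseteq> {..<d}}"
  have card: "card ?A = d ^ v"
    using card_lists_length_eq[of "{..<d}" v] by (simp add: conj_commute)
  show "(SUP w \<in> carrier_vec d -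
          (enlarged_rect d a b (2 * \<epsilon> * \<kappa> + 1 / \<phi>) - enlarged_rect d a b (- (2 * \<epsilon> * \<kappa>))).
         \<Sum>js \<in> ?A. SUP y \<in> cube d (\<epsilon> * sigma_star S * \<eta>).
             ennreal \<bar>partial_derivs d js (rho d a b \<phi> \<epsilon> S) (w + y)\<bar>)
      \<le> ennreal (tail_const v * (real d ^ v / (\<epsilon> * sigma_star S) ^ v) * exp (- ((\<kappa> - \<eta>)\<^sup>2) / 4))"
  proof (rule SUP_least)
    fix w assume w: "w \<in> carrier_vec d -
          (enlarged_rect d a b (2 * \<epsilon> * \<kappa> + 1 / \<phi>) - enlarged_rect d a b (- (2 * \<epsilon> * \<kappa>)))"
    have "(\<Sum>js \<in> ?A. SUP y \<in> cube d (\<epsilon> * sigma_star S * \<eta>).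
             ennreal \<bar>partial_derivs d js (rho d a b \<phi> \<epsilon> S) (w + y)\<bar>) \<le> of_nat (card ?A) * ennreal ?R"
    proof (rule sum_bounded_above, rule SUP_least, rule ennreal_leI)
      fix js y assume js: "js \<in> ?A" and y: "y \<in> cube d (\<epsilon> * sigma_star S * \<eta>)"
      have "js \<noteq> []" using js assms by auto
      then show "\<bar>partial_derivs d js (rho d a b \<phi> \<epsilon> S) (w + y)\<bar> \<le> ?R"
        using partial_derivs_rect_ramp_bound[OF \<phi> \<epsilon> _ _ _ \<kappa> _ _ y, of js w a b] js w d
        by (auto simp: rho_eq_smoothing[OF S diag d0])
    qed
    also have "\<dots> = ennreal (real (d ^ v) * ?R)"
      unfolding card ennreal_of_nat_eq_real_of_nat by (rule ennreal_mult'[symmetric]) simp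
    also have "real (d ^ v) * ?R = tail_const v * (real d ^ v / (\<epsilon> * sigma_star S) ^ v) * exp (- ((\<kappa> - \<eta>)\<^sup>2) / 4)"
      by (simp add: mult_ac)
    finally show "(\<Sum>js \<in> ?A. SUP y \<in> cube d (\<epsilon> * sigma_star S * \<eta>).
             ennreal \<bar>partial_derivs d js (rho d a b \<phi> \<epsilon> S) (w + y)\<bar>) \<le>
       ennreal (tail_const v * (real d ^ v / (\<epsilon> * sigma_star S) ^ v) * exp (- ((\<kappa> - \<eta>)\<^sup>2) / 4))" .
  qed
qed

end
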